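(* Let $R$ be a ring and let $\mathcal{X}=\{X_i\}_{i\in I}$ be a set of pairwise comaximal ideals of $R$. For each right $R$-module $M$ let $\gamma(M)$ be the set of all $m\in M$ for which there exist a nonempty finite subset $J\subseteq I$ and positive integers $k_i$ ($i\in J$) with $\bigcap_{i\in J}X_i^{k_i}\subseteq\underline{r}_R(mR)$. Then: (1) $\gamma$ is a left exact preradical. (2) $\gamma(M)=\bigoplus_{i\in I}C(X_i)$ for every right $R$-module $M$. In particular, $M$ is pretorsion-free (i.e., $\gamma(M)=0$) if and only if $\underline{\ell}_M(X_i^{k_i})=0$ for each $i\in I$ and each $k_i\geq 1$. (3) If either of the following conditions holds: (a) $\bigl(\bigcap_{i\in J}X_i^{k_i}\bigr)^k$ is finitely generated for every nonempty finite subset $J\subseteq I$ and all $k,k_i\geq 1$; or (b) $I$ is finite and for every choice of $k_i\geq 1$ ($i\in I$), $\bigl(\bigcap_{i\in I}X_i^{k_i}\bigr)^k=\bigl(\bigcap_{i\in I}X_i^{k_i}\bigr)^{k+1}$ for some $k\geq 1$, then $\rho$, defined by $$\rho(M)=\Bigl\{m\in M\Bigm| \Bigl(\bigcap_{i\in J}X_i^{k_i}\Bigr)^n\subseteq\underline{r}_R(mR)\text{ for some nonempty finite subset }J\subseteq I\text{ and some }k_i,n\geq 1\Bigr\},$$ is the smallest radical larger than $\gamma$ (i.e., $\rho=\bar{\gamma}$).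
   Context: Rings are associative with identity, not necessarily commutative; modules are unital right modules; ideals are two-sided. A nonempty family $\{X_i\}_{i\in I}$ of ideals of $R$ is pairwise comaximal if $X_i+X_j=R$ for all $i\neq j$ in $I$. For $X\subseteq R$, $\underline{\ell}_M(X)=\{m\in M\mid mx=0\text{ for all }x\in X\}$; for $N\subseteq M$, $\underline{r}_R(N)=\{r\in R\mid nr=0\text{ for all }n\in N\}$. For an ideal $X$ of $R$, the component of $X$ in $M$ is $C(X)=\sum_{k\ge 1}\underline{\ell}_M(X^k)$. Direct sums of submodules are internal. A preradical $\tau$ on the category of right $R$-modules assigns to each module $M$ a submodule $\tau(M)\le M$ such that $f(\tau(M))\subseteq\tau(N)$ for every homomorphism $f:M\to N$. It is left exact if $\tau(N)=N\cap\tau(M)$ for all $N\le M$, and it is a radical if $\tau(M/\tau(M))=0$ for all $M$. Preradicals are ordered by $\sigma\le\tau$ iff $\sigma(M)\subseteq\tau(M)$ for all $M$; "larger than" is in the sense of this (non-strict) order. The radical closure $\bar{\gamma}$ is the smallest radical $\tau$ with $\gamma\le\tau$. *)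

theory Defs
  imports "HOL-Algebra.Module" "HOL-Algebra.Ideal_Product"
begin

section \<open>Right modules over a noncommutative ring\<close>

text \<open>
  The record \<^type>\<open>module\<close> of the library is used for the carrier, the addition and the
  scalar action; the library's locale \<^locale>\<open>module\<close> requires a commutative ring and is
  not used. The field \<^const>\<open>smult\<close> takes the scalar first, so the right action
  \<open>m r\<close> is \<open>smult M r m\<close>, written \<open>m \<bullet>\<^bsub>M\<^esub> r\<close> below. The
  inherited fields \<open>mult\<close> and \<open>one\<close> carry no information.
\<close>

abbreviation ract :: "('r, 'm, 'z) module_scheme \<Rightarrow> 'm \<Rightarrow> 'r \<Rightarrow> 'm"
    (infixl \<open>\<bullet>\<index>\<close> 70)
  where "m \<bullet>\<^bsub>M\<^esub> r \<equiv> r \<odot>\<^bsub>M\<^esub> m"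

locale right_module = R?: ring R + M?: abelian_group M
  for R :: "('r, 'x) ring_scheme" (structure) and M :: "('r, 'm) module" (structure) +
  assumes ract_closed: "\<lbrakk>m \<in> carrier M; r \<in> carrier R\<rbrakk> \<Longrightarrow> m \<bullet>\<^bsub>M\<^esub> r \<in> carrier M"
    and ract_add_scalar: "\<lbrakk>m \<in> carrier M; r \<in> carrier R; s \<in> carrier R\<rbrakk>
      \<Longrightarrow> m \<bullet>\<^bsub>M\<^esub> (r \<oplus>\<^bsub>R\<^esub> s) = m \<bullet>\<^bsub>M\<^esub> r \<oplus>\<^bsub>M\<^esub> m \<bullet>\<^bsub>M\<^esub> s"
    and ract_add: "\<lbrakk>m \<in> carrier M; n \<in> carrier M; r \<in> carrier R\<rbrakk>
      \<Longrightarrow> (m \<oplus>\<^bsub>M\<^esub> n) \<bullet>\<^bsub>M\<^esub> r = m \<bullet>\<^bsub>M\<^esub> r \<oplus>\<^bsub>M\<^esub> n \<bullet>\<^bsub>M\<^esub> r"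
    and ract_assoc: "\<lbrakk>m \<in> carrier M; r \<in> carrier R; s \<in> carrier R\<rbrakk>
      \<Longrightarrow> m \<bullet>\<^bsub>M\<^esub> (r \<otimes>\<^bsub>R\<^esub> s) = (m \<bullet>\<^bsub>M\<^esub> r) \<bullet>\<^bsub>M\<^esub> s"
    and ract_one: "m \<in> carrier M \<Longrightarrow> m \<bullet>\<^bsub>M\<^esub> \<one>\<^bsub>R\<^esub> = m"

text \<open>
  The library locale \<^locale>\<open>submodule\<close> does not presuppose \<^locale>\<open>module\<close>:
  it asserts an additive subgroup closed under \<^const>\<open>smult\<close>, so it is the notion of
  submodule of a right module as well.
\<close>

definition rmod_hom :: "('r, 'x) ring_scheme \<Rightarrow> ('r, 'm) module \<Rightarrow> ('r, 'n) module \<Rightarrow> ('m \<Rightarrow> 'n) set"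
  where "rmod_hom R M N = {f \<in> carrier M \<rightarrow> carrier N.
    (\<forall>m\<in>carrier M. \<forall>m'\<in>carrier M. f (m \<oplus>\<^bsub>M\<^esub> m') = f m \<oplus>\<^bsub>N\<^esub> f m') \<and>
    (\<forall>m\<in>carrier M. \<forall>r\<in>carrier R. f (m \<bullet>\<^bsub>M\<^esub> r) = f m \<bullet>\<^bsub>N\<^esub> r)}"

definition rmod_isomorphic :: "('r, 'x) ring_scheme \<Rightarrow> ('r, 'm) module \<Rightarrow> ('r, 'n) module \<Rightarrow> bool"
  where "rmod_isomorphic R M N \<longleftrightarrow> (\<exists>f \<in> rmod_hom R M N. bij_betw f (carrier M) (carrier N))"

definition quot_module :: "('r, 'm) module \<Rightarrow> 'm set \<Rightarrow> ('r, 'm set) module"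
  where "quot_module M N = \<lparr>carrier = a_rcosets\<^bsub>M\<^esub> N, mult = undefined, one = undefined,
    zero = N, add = set_add M,
    smult = (\<lambda>r C. \<Union>m\<in>C. N +>\<^bsub>M\<^esub> (m \<bullet>\<^bsub>M\<^esub> r))\<rparr>"

definition rspan :: "('r, 'x) ring_scheme \<Rightarrow> ('r, 'm) module \<Rightarrow> 'm set \<Rightarrow> 'm set"
  where "rspan R M S = \<Inter>{N. submodule N R M \<and> S \<subseteq> N}"

definition submodule_sum ::
    "('r, 'x) ring_scheme \<Rightarrow> ('r, 'm) module \<Rightarrow> 'i set \<Rightarrow> ('i \<Rightarrow> 'm set) \<Rightarrow> 'm set"
  where "submodule_sum R M I A = rspan R M (\<Union>i\<in>I. A i)"

definition internal_direct_sum ::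
    "('r, 'x) ring_scheme \<Rightarrow> ('r, 'm) module \<Rightarrow> 'i set \<Rightarrow> ('i \<Rightarrow> 'm set) \<Rightarrow> 'm set \<Rightarrow> bool"
  where "internal_direct_sum R M I A S \<longleftrightarrow>
    (\<forall>i\<in>I. submodule (A i) R M) \<and>
    S = submodule_sum R M I A \<and>
    (\<forall>i\<in>I. A i \<inter> submodule_sum R M (I - {i}) A = {\<zero>\<^bsub>M\<^esub>})"

definition cyclic_submodule :: "('r, 'x) ring_scheme \<Rightarrow> ('r, 'm) module \<Rightarrow> 'm \<Rightarrow> 'm set"
  where "cyclic_submodule R M m = {m \<bullet>\<^bsub>M\<^esub> r | r. r \<in> carrier R}"

definition left_ann :: "('r, 'm) module \<Rightarrow> 'r set \<Rightarrow> 'm set"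
  where "left_ann M X = {m \<in> carrier M. \<forall>x\<in>X. m \<bullet>\<^bsub>M\<^esub> x = \<zero>\<^bsub>M\<^esub>}"

definition right_ann :: "('r, 'x) ring_scheme \<Rightarrow> ('r, 'm) module \<Rightarrow> 'm set \<Rightarrow> 'r set"
  where "right_ann R M N = {r \<in> carrier R. \<forall>n\<in>N. n \<bullet>\<^bsub>M\<^esub> r = \<zero>\<^bsub>M\<^esub>}"


section \<open>Ideals\<close>

text \<open>\<^const>\<open>ideals_set\<close> has the ideal product as multiplication and the whole ring as unit.\<close>

definition ideal_pow :: "('r, 'x) ring_scheme \<Rightarrow> 'r set \<Rightarrow> nat \<Rightarrow> 'r set"
  where "ideal_pow R X k = X [^]\<^bsub>ideals_set R\<^esub> k"

definition pairwise_comaximal :: "('r, 'x) ring_scheme \<Rightarrow> 'i set \<Rightarrow> ('i \<Rightarrow> 'r set) \<Rightarrow> bool"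
  where "pairwise_comaximal R I X \<longleftrightarrow>
    (\<forall>i\<in>I. \<forall>j\<in>I. i \<noteq> j \<longrightarrow> X i <+>\<^bsub>R\<^esub> X j = carrier R)"

definition regular_module :: "('r, 'x) ring_scheme \<Rightarrow> ('r, 'r) module"
  where "regular_module R = \<lparr>carrier = carrier R, mult = mult R, one = one R,
    zero = zero R, add = add R, smult = (\<lambda>r x. x \<otimes>\<^bsub>R\<^esub> r)\<rparr>"

text \<open>
  In the setting of right modules, an ideal is finitely generated if it is so as a right ideal,
  i.e. as a submodule of the right module \<open>R\<close>.
\<close>

definition fin_gen_ideal :: "('r, 'x) ring_scheme \<Rightarrow> 'r set \<Rightarrow> bool"
  where "fin_gen_ideal R A \<longleftrightarrow>
    (\<exists>S. finite S \<and> S \<subseteq> carrier R \<and> A = rspan R (regular_module R) S)"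

definition component :: "('r, 'x) ring_scheme \<Rightarrow> ('r, 'm) module \<Rightarrow> 'r set \<Rightarrow> 'm set"
  where "component R M X = submodule_sum R M {k::nat. 1 \<le> k} (\<lambda>k. left_ann M (ideal_pow R X k))"

definition inter_pow :: "('r, 'x) ring_scheme \<Rightarrow> ('i \<Rightarrow> 'r set) \<Rightarrow> 'i set \<Rightarrow> ('i \<Rightarrow> nat) \<Rightarrow> 'r set"
  where "inter_pow R X J k = (\<Inter>i\<in>J. ideal_pow R (X i) (k i))"


section \<open>Preradicals\<close>

text \<open>
  The modules under consideration are all right \<open>R\<close>-modules whose carrier is a set of
  elements of the type \<open>'m\<close>, which is arbitrary. Up to isomorphism this class is closed
  under submodules and quotients (for the latter see \<open>ex_quotient_copy\<close> below). Values
  outside the class of right modules are irrelevant: all notions only look at right modules.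
\<close>

type_synonym ('r, 'm) submodule_assignment = "('r, 'm) module \<Rightarrow> 'm set"

definition preradical :: "('r, 'x) ring_scheme \<Rightarrow> ('r, 'm) submodule_assignment \<Rightarrow> bool"
  where "preradical R \<tau> \<longleftrightarrow>
    (\<forall>M. right_module R M \<longrightarrow> submodule (\<tau> M) R M) \<and>
    (\<forall>M N f. right_module R M \<and> right_module R N \<and> f \<in> rmod_hom R M N \<longrightarrow> f ` \<tau> M \<subseteq> \<tau> N)"

definition left_exact :: "('r, 'x) ring_scheme \<Rightarrow> ('r, 'm) submodule_assignment \<Rightarrow> bool"
  where "left_exact R \<tau> \<longleftrightarrow>
    (\<forall>M N. right_module R M \<and> submodule N R M \<longrightarrow> \<tau> (M\<lparr>carrier := N\<rparr>) = N \<inter> \<tau> M)"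

text \<open>
  The cosets of \<open>\<tau> M\<close> have type \<open>'m set\<close>, so \<open>\<tau>\<close> cannot be applied
  to \<^const>\<open>quot_module\<close> itself; it is applied to all copies \<open>Q\<close> of the
  quotient in the class.
\<close>

definition radical :: "('r, 'x) ring_scheme \<Rightarrow> ('r, 'm) submodule_assignment \<Rightarrow> bool"
  where "radical R \<tau> \<longleftrightarrow> preradical R \<tau> \<and>
    (\<forall>M Q. right_module R M \<and> right_module R Q \<and> rmod_isomorphic R Q (quot_module M (\<tau> M))
      \<longrightarrow> \<tau> Q = {\<zero>\<^bsub>Q\<^esub>})"

definition preradical_le ::
    "('r, 'x) ring_scheme \<Rightarrow> ('r, 'm) submodule_assignment \<Rightarrow> ('r, 'm) submodule_assignment \<Rightarrow> bool"
  where "preradical_le R \<sigma> \<tau> \<longleftrightarrow> (\<forall>M. right_module R M \<longrightarrow> \<sigma> M \<subseteq> \<tau> M)"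

definition is_radical_closure ::
    "('r, 'x) ring_scheme \<Rightarrow> ('r, 'm) submodule_assignment \<Rightarrow> ('r, 'm) submodule_assignment \<Rightarrow> bool"
  where "is_radical_closure R \<gamma> \<rho> \<longleftrightarrow>
    radical R \<rho> \<and> preradical_le R \<gamma> \<rho> \<and>
    (\<forall>\<tau>. radical R \<tau> \<and> preradical_le R \<gamma> \<tau> \<longrightarrow> preradical_le R \<rho> \<tau>)"

definition gamma_pre :: "('r, 'x) ring_scheme \<Rightarrow> 'i set \<Rightarrow> ('i \<Rightarrow> 'r set) \<Rightarrow> ('r, 'm) submodule_assignment"
  where "gamma_pre R I X M = {m \<in> carrier M. \<exists>J k.
    finite J \<and> J \<noteq> {} \<and> J \<subseteq> I \<and> (\<forall>i\<in>J. 1 \<le> k i) \<and>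
    inter_pow R X J k \<subseteq> right_ann R M (cyclic_submodule R M m)}"

definition rho_pre :: "('r, 'x) ring_scheme \<Rightarrow> 'i set \<Rightarrow> ('i \<Rightarrow> 'r set) \<Rightarrow> ('r, 'm) submodule_assignment"
  where "rho_pre R I X M = {m \<in> carrier M. \<exists>J k n.
    finite J \<and> J \<noteq> {} \<and> J \<subseteq> I \<and> (\<forall>i\<in>J. 1 \<le> k i) \<and> 1 \<le> n \<and>
    ideal_pow R (inter_pow R X J k) n \<subseteq> right_ann R M (cyclic_submodule R M m)}"


section \<open>Quotients exist inside the class\<close>

context right_module
begin

lemma submodule_abelian_subgroup:
  assumes "submodule N R M"
  shows "abelian_subgroup N M"
proof (rule abelian_subgroupI3)
  show "additive_subgroup N M" using assms by (simp add: additive_subgroup_def submodule_def)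
qed (rule M.abelian_group_axioms)

lemma quot_ract:
  assumes N: "submodule N R M" and m: "m \<in> carrier M" and r: "r \<in> carrier R"
  shows "(\<Union>x \<in> N +>\<^bsub>M\<^esub> m. N +>\<^bsub>M\<^esub> (x \<bullet>\<^bsub>M\<^esub> r)) = N +>\<^bsub>M\<^esub> (m \<bullet>\<^bsub>M\<^esub> r)"
proof -
  interpret N: abelian_subgroup N M using submodule_abelian_subgroup[OF N] .
  have "N +>\<^bsub>M\<^esub> (x \<bullet>\<^bsub>M\<^esub> r) = N +>\<^bsub>M\<^esub> (m \<bullet>\<^bsub>M\<^esub> r)" if x: "x \<in> N +>\<^bsub>M\<^esub> m" for x
  proof -
    obtain n where n: "n \<in> N" "x = n \<oplus>\<^bsub>M\<^esub> m"
      using x by (auto simp: a_r_coset_def')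
    have nr: "n \<bullet>\<^bsub>M\<^esub> r \<in> N" using N n r by (simp add: submodule.smult_closed)
    have "x \<bullet>\<^bsub>M\<^esub> r = n \<bullet>\<^bsub>M\<^esub> r \<oplus>\<^bsub>M\<^esub> m \<bullet>\<^bsub>M\<^esub> r"
      using n m r by (simp add: ract_add)
    then have "x \<bullet>\<^bsub>M\<^esub> r \<in> N +>\<^bsub>M\<^esub> (m \<bullet>\<^bsub>M\<^esub> r)"
      using nr by (auto simp: a_r_coset_def')
    then show ?thesis
      using M.a_repr_independence'[folded a_r_coset_def, OF _ ract_closed[OF m r] N.a_subgroup] by simp
  qed
  moreover have "m \<in> N +>\<^bsub>M\<^esub> m" using m by (rule N.a_rcos_self)
  ultimately show ?thesis by blast
qed

lemma ex_quotient_copy: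
  assumes N: "submodule N R M"
  shows "\<exists>Q :: ('r, 'm) module. right_module R Q \<and> rmod_isomorphic R Q (quot_module M N)"
    \<comment> \<open>the elements of the copy are chosen representatives of the cosets\<close>
proof -
  interpret N: abelian_subgroup N M using submodule_abelian_subgroup[OF N] .
  define e where "e C = (SOME x. x \<in> C)" for C :: "'m set"
  define p where "p x = e (N +>\<^bsub>M\<^esub> x)" for x
  define Q :: "('r, 'm) module" where "Q = \<lparr>carrier = p ` carrier M, mult = undefined,
    one = undefined, zero = p \<zero>\<^bsub>M\<^esub>, add = (\<lambda>x y. p (x \<oplus>\<^bsub>M\<^esub> y)), smult = (\<lambda>r x. p (x \<bullet>\<^bsub>M\<^esub> r))\<rparr>"
  have e_in: "p x \<in> N +>\<^bsub>M\<^esub> x" if "x \<in> carrier M" for x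
    unfolding p_def e_def using N.a_rcos_self[OF that] by (rule someI)
  have p_in: "p x \<in> carrier M" if "x \<in> carrier M" for x
    using e_in[OF that] N.a_elemrcos_carrier that by blast
  have Np: "N +>\<^bsub>M\<^esub> p x = N +>\<^bsub>M\<^esub> x" if "x \<in> carrier M" for x
    using M.a_repr_independence'[folded a_r_coset_def, OF e_in[OF that] that N.a_subgroup] by simp
  have p_add: "p (p a \<oplus>\<^bsub>M\<^esub> p b) = p (a \<oplus>\<^bsub>M\<^esub> b)" if "a \<in> carrier M" "b \<in> carrier M" for a b
  proof -
    have "N +>\<^bsub>M\<^esub> (p a \<oplus>\<^bsub>M\<^esub> p b) = (N +>\<^bsub>M\<^esub> p a) <+>\<^bsub>M\<^esub> (N +>\<^bsub>M\<^esub> p b)"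
      using that by (simp add: N.a_rcos_sum p_in)
    also have "\<dots> = N +>\<^bsub>M\<^esub> (a \<oplus>\<^bsub>M\<^esub> b)" using that by (simp add: Np N.a_rcos_sum)
    finally show ?thesis by (simp add: p_def)
  qed
  have p_ract: "p (p a \<bullet>\<^bsub>M\<^esub> r) = p (a \<bullet>\<^bsub>M\<^esub> r)" if "a \<in> carrier M" "r \<in> carrier R" for a r
    using quot_ract[OF N p_in[OF that(1)] that(2)] quot_ract[OF N that] Np[OF that(1)]
    by (simp add: p_def)
  have "abelian_group Q"
  proof (rule abelian_groupI)
    fix x assume "x \<in> carrier Q"
    then obtain a where a: "a \<in> carrier M" "x = p a" by (auto simp: Q_def)
    have "p (\<ominus>\<^bsub>M\<^esub> a) \<in> carrier Q \<and> p (\<ominus>\<^bsub>M\<^esub> a) \<oplus>\<^bsub>Q\<^esub> x = \<zero>\<^bsub>Q\<^esub>"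
      using a by (simp add: Q_def p_add M.l_neg)
    then show "\<exists>y\<in>carrier Q. y \<oplus>\<^bsub>Q\<^esub> x = \<zero>\<^bsub>Q\<^esub>" by blast
  qed (auto simp: Q_def p_add M.a_ac)
  moreover have "right_module_axioms R Q"
    by unfold_locales
      (auto simp: Q_def p_add p_ract ract_closed ract_add ract_add_scalar ract_assoc ract_one)
  ultimately have Q: "right_module R Q"
    by (intro right_module.intro R.ring_axioms)
  have "(\<lambda>x. N +>\<^bsub>M\<^esub> x) \<in> rmod_hom R Q (quot_module M N)"
    unfolding rmod_hom_def
    by (auto simp: Q_def quot_module_def p_add p_ract Np p_in ract_closed quot_ract[OF N]
        N.a_rcos_sum N.a_subset M.a_rcosetsI)
  moreover have "bij_betw (\<lambda>x. N +>\<^bsub>M\<^esub> x) (carrier Q) (carrier (quot_module M N))"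
  proof (rule bij_betw_byWitness[where f' = e])
    show "\<forall>x\<in>carrier Q. e (N +>\<^bsub>M\<^esub> x) = x"
      by (auto simp: Q_def Np) (simp add: p_def)
    show "\<forall>C\<in>carrier (quot_module M N). N +>\<^bsub>M\<^esub> e C = C"
      by (auto simp: quot_module_def A_RCOSETS_def' Np[unfolded p_def])
    show "(\<lambda>x. N +>\<^bsub>M\<^esub> x) ` carrier Q \<subseteq> carrier (quot_module M N)"
      by (auto simp: Q_def quot_module_def A_RCOSETS_def' Np)
    show "e ` carrier (quot_module M N) \<subseteq> carrier Q"
      by (auto simp: Q_def quot_module_def A_RCOSETS_def' p_def)
  qed
  ultimately show ?thesis using Q unfolding rmod_isomorphic_def by blast
qed

end

end

theory Submission
  imports Defs
begin

text \<open>
  For an ideal \<open>A\<close>, the condition \<open>A \<subseteq> r\<^sub>R(m R)\<close> just says \<open>m A = 0\<close>. So \<open>\<gamma>\<close> and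
  \<open>\<rho>\<close> both arise from a downward directed family of ideals, as the elements
  killed by some member of the family; this makes \<open>\<gamma>\<close> a left exact preradical.
  If \<open>A + B = R\<close> and \<open>1 = a + b\<close>, an element \<open>m\<close> killed by \<open>A \<inter> B\<close> is
  \<open>m b + m a\<close> with \<open>m b A = 0\<close> and \<open>m a B = 0\<close>, which gives the direct sum.
  Every radical above \<open>\<gamma>\<close> contains \<open>\<rho>\<close> without further hypotheses. Under (a),
  if \<open>m K\<close> lies in \<open>\<rho>(M)\<close> for a finitely generated \<open>K\<close>, then one member \<open>L\<close> of the
  family kills \<open>m s\<close> for all generators \<open>s\<close> of \<open>K\<close>, so \<open>m K L = 0\<close>; under (b) the family
  has an idempotent least member \<open>E\<close> and \<open>\<rho>(M)\<close> is the annihilator of \<open>E\<close>.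
\<close>

section \<open>Powers and comaximality of ideals\<close>

lemma ideal_prod_mono:
  assumes "A \<subseteq> A'" "B \<subseteq> B'"
  shows "A \<cdot>\<^bsub>R\<^esub> B \<subseteq> A' \<cdot>\<^bsub>R\<^esub> B'"
proof
  fix x assume "x \<in> A \<cdot>\<^bsub>R\<^esub> B"
  then show "x \<in> A' \<cdot>\<^bsub>R\<^esub> B'"
    by induct (use assms in \<open>auto intro: ideal_prod.intros\<close>)
qed

lemma ideal_pow_0: "ideal_pow R X 0 = carrier R"
  by (simp add: ideal_pow_def ideals_set_def nat_pow_def)

lemma ideal_pow_Suc: "ideal_pow R X (Suc n) = ideal_pow R X n \<cdot>\<^bsub>R\<^esub> X"
  by (simp add: ideal_pow_def ideals_set_def nat_pow_def)

lemma ideal_pow_mono: "A \<subseteq> B \<Longrightarrow> ideal_pow R A n \<subseteq> ideal_pow R B n"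
  by (induct n) (simp_all add: ideal_pow_0 ideal_pow_Suc ideal_prod_mono)

context ring
begin

lemma ideal_prod_carrier_left:
  assumes "ideal A R"
  shows "carrier R \<cdot> A = A"
proof
  show "carrier R \<cdot> A \<subseteq> A"
    using ideal_prod_inter[OF oneideal assms] by simp
  show "A \<subseteq> carrier R \<cdot> A"
    using ideal_prod.prod[of \<one> "carrier R" _ A R] ideal.Icarr[OF assms] by fastforce
qed

lemma ideal_ideal_pow: "ideal X R \<Longrightarrow> ideal (ideal_pow R X n) R"
  by (induct n) (simp_all add: ideal_pow_0 ideal_pow_Suc oneideal ideal_prod_is_ideal)

lemma ideal_pow_1: "ideal X R \<Longrightarrow> ideal_pow R X (Suc 0) = X"
  by (simp add: ideal_pow_Suc ideal_pow_0 ideal_prod_carrier_left)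

lemma ideal_pow_add:
  assumes "ideal X R"
  shows "ideal_pow R X (m + n) = ideal_pow R X m \<cdot> ideal_pow R X n"
  by (induct n)
    (simp_all add: assms ideal_pow_0 ideal_pow_Suc ideal_prod_one ideal_ideal_pow ideal_prod_assoc)

lemma ideal_pow_antimono:
  assumes "ideal X R" "m \<le> n"
  shows "ideal_pow R X n \<subseteq> ideal_pow R X m"
proof -
  obtain p where "n = m + p"
    using assms(2) le_Suc_ex by blast
  then show ?thesis
    using ideal_prod_inter assms(1) by (simp add: ideal_pow_add ideal_ideal_pow)
qed

text \<open>One stationary step freezes all later powers: X^(n+p+1) = X^(n+p) X = X^n X = X^(n+1) =
  X^n.\<close>

lemma ideal_pow_stable:
  assumes "ideal X R" "ideal_pow R X n = ideal_pow R X (n + 1)"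
  shows "ideal_pow R X (n + p) = ideal_pow R X n"
proof (induct p)
  case (Suc p)
  have "ideal_pow R X (n + Suc p) = ideal_pow R X (n + p) \<cdot> X"
    by (simp add: ideal_pow_Suc)
  also have "\<dots> = ideal_pow R X (n + 1)"
    by (simp add: Suc ideal_pow_Suc)
  finally show ?case
    using assms(2) by simp
qed simp

section \<open>Comaximal pairs of ideals\<close>

lemma comaximal_iff:
  assumes "ideal A R" "ideal B R"
  shows "A <+> B = carrier R \<longleftrightarrow> (\<exists>a\<in>A. \<exists>b\<in>B. \<one> = a \<oplus> b)"
proof
  assume "A <+> B = carrier R"
  then have "\<one> \<in> A <+> B"
    by simp
  then show "\<exists>a\<in>A. \<exists>b\<in>B. \<one> = a \<oplus> b"
    by (simp add: set_add_def')
next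
  assume "\<exists>a\<in>A. \<exists>b\<in>B. \<one> = a \<oplus> b"
  then have "\<one> \<in> A <+> B"
    by (simp add: set_add_def')
  then show "A <+> B = carrier R"
    using ideal.one_imp_carrier[OF add_ideals[OF assms]] by simp
qed

lemma comaximal_sym:
  assumes "ideal A R" "ideal B R" "A <+> B = carrier R"
  shows "B <+> A = carrier R"
  using assms set_add_comm[of A B] additive_subgroup.a_subset[OF ideal.axioms(1)] by metis

text \<open>From 1 = a + b and 1 = a' + c one gets 1 = a + b (a' + c) = (a + b a') + b c. The first
  summand stays in A because A is closed under multiplication from the left; no commutativity
  enters.\<close>

lemma comaximal_prod:
  assumes A: "ideal A R" and B: "ideal B R" and C: "ideal C R"
    and AB: "A <+> B = carrier R" and AC: "A <+> C = carrier R"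
  shows "A <+> (B \<cdot> C) = carrier R"
proof -
  obtain a b where ab: "a \<in> A" "b \<in> B" "\<one> = a \<oplus> b"
    using AB comaximal_iff[OF A B] by auto
  obtain a' c where ac: "a' \<in> A" "c \<in> C" "\<one> = a' \<oplus> c"
    using AC comaximal_iff[OF A C] by auto
  have carr: "a \<in> carrier R" "b \<in> carrier R" "a' \<in> carrier R" "c \<in> carrier R"
    using ab ac A B C by (auto intro: ideal.Icarr)
  have "\<one> = a \<oplus> b \<otimes> (a' \<oplus> c)"
    using ab ac carr by (metis r_one)
  then have "\<one> = (a \<oplus> b \<otimes> a') \<oplus> b \<otimes> c"
    using carr by (simp add: r_distr a_assoc)
  moreover have "a \<oplus> b \<otimes> a' \<in> A"
    using A ab ac carr
    by (simp add: ideal.I_l_closed additive_subgroup.a_closed[OF ideal.axioms(1)])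
  moreover have "b \<otimes> c \<in> B \<cdot> C"
    using ab ac by (intro ideal_prod.prod)
  ultimately show ?thesis
    using comaximal_iff[OF A ideal_prod_is_ideal[OF B C]] by blast
qed

lemma comaximal_mono:
  assumes "ideal A R" "ideal B R" "ideal B' R" "B \<subseteq> B'" "A <+> B = carrier R"
  shows "A <+> B' = carrier R"
  using assms by (meson comaximal_iff subsetD)

text \<open>The product of B and C lies in their intersection, so comaximality with the product
  passes up to the intersection.\<close>

lemma comaximal_Int:
  assumes "ideal A R" "ideal B R" "ideal C R" "A <+> B = carrier R" "A <+> C = carrier R"
  shows "A <+> (B \<inter> C) = carrier R"
  using comaximal_mono[OF assms(1) ideal_prod_is_ideal[OF assms(2,3)] i_intersect[OF assms(2,3)]
      ideal_prod_inter[OF assms(2,3)] comaximal_prod[OF assms]] .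

lemma comaximal_pow:
  assumes "ideal A R" "ideal B R" "A <+> B = carrier R"
  shows "A <+> ideal_pow R B n = carrier R"
proof (induct n)
  case 0
  have "\<zero> \<in> A" "\<one> = \<zero> \<oplus> \<one>"
    using assms(1) by (simp_all add: additive_subgroup.zero_closed ideal.axioms(1))
  then show ?case
    using comaximal_iff[OF assms(1) oneideal] one_closed unfolding ideal_pow_0 by blast
next
  case (Suc n)
  then show ?case
    using assms by (simp add: ideal_pow_Suc comaximal_prod ideal_ideal_pow)
qed

text \<open>The two ideals are raised to powers one at a time, with \<open>comaximal_sym\<close>
  swapping their roles in between.\<close>

lemma comaximal_pow_pow:
  assumes "ideal A R" "ideal B R" "A <+> B = carrier R"
  shows "ideal_pow R A m <+> ideal_pow R B n = carrier R"
  using assms by (meson comaximal_pow comaximal_sym ideal_ideal_pow)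

text \<open>The index set must be nonempty: an empty intersection is the universe of the type, which
  need not be the carrier of the ring.\<close>

lemma ideal_inter_pow:
  assumes "finite J" "J \<noteq> {}" "\<And>i. i \<in> J \<Longrightarrow> ideal (X i) R"
  shows "ideal (inter_pow R X J k) R"
  unfolding inter_pow_def using assms by (intro i_Intersect) (auto intro: ideal_ideal_pow)

text \<open>Induction on J, adding one power at a time by \<open>comaximal_Int\<close>. It reduces a
  finite intersection to the two-ideal arguments about annihilators below.\<close>

lemma comaximal_inter_pow:
  assumes "finite J" "J \<noteq> {}" "\<And>j. j \<in> J \<Longrightarrow> ideal (X j) R"
    and A: "ideal A R" and "\<And>j. j \<in> J \<Longrightarrow> A <+> X j = carrier R"
  shows "A <+> inter_pow R X J k = carrier R"
  using assms(1,2,3,5)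
proof (induct J rule: finite_ne_induct)
  case (singleton j)
  then show ?case
    using A by (simp add: inter_pow_def comaximal_pow)
next
  case (insert j J)
  have "A <+> (ideal_pow R (X j) (k j) \<inter> inter_pow R X J k) = carrier R"
    using insert A by (intro comaximal_Int ideal_ideal_pow ideal_inter_pow comaximal_pow) auto
  then show ?case
    by (simp add: inter_pow_def)
qed

end

section \<open>Submodules and annihilators\<close>

context right_module
begin

lemma zero_ract: "r \<in> carrier R \<Longrightarrow> \<zero>\<^bsub>M\<^esub> \<bullet>\<^bsub>M\<^esub> r = \<zero>\<^bsub>M\<^esub>"
  using ract_add[of "\<zero>\<^bsub>M\<^esub>" "\<zero>\<^bsub>M\<^esub>" r] ract_closed[of "\<zero>\<^bsub>M\<^esub>" r]
  by (metis M.l_zero M.add.r_cancel_one' M.zero_closed)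

lemma ract_zero: "m \<in> carrier M \<Longrightarrow> m \<bullet>\<^bsub>M\<^esub> \<zero>\<^bsub>R\<^esub> = \<zero>\<^bsub>M\<^esub>"
  using ract_add_scalar[of m "\<zero>\<^bsub>R\<^esub>" "\<zero>\<^bsub>R\<^esub>"] ract_closed[of m "\<zero>\<^bsub>R\<^esub>"]
  by (metis R.l_zero M.add.r_cancel_one' R.zero_closed)

text \<open>Closure under negation follows from closure under the action, since -a = a (-1).\<close>

lemma submoduleI:
  assumes sub: "H \<subseteq> carrier M" and zero: "\<zero>\<^bsub>M\<^esub> \<in> H"
    and add: "\<And>a b. \<lbrakk>a \<in> H; b \<in> H\<rbrakk> \<Longrightarrow> a \<oplus>\<^bsub>M\<^esub> b \<in> H"
    and ract: "\<And>a r. \<lbrakk>a \<in> H; r \<in> carrier R\<rbrakk> \<Longrightarrow> a \<bullet>\<^bsub>M\<^esub> r \<in> H"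
  shows "submodule H R M"
proof -
  have "\<ominus>\<^bsub>M\<^esub> a \<in> H" if a: "a \<in> H" for a
  proof -
    have a': "a \<in> carrier M"
      using a sub by auto
    have "a \<bullet>\<^bsub>M\<^esub> (\<ominus>\<^bsub>R\<^esub> \<one>\<^bsub>R\<^esub>) \<oplus>\<^bsub>M\<^esub> a = a \<bullet>\<^bsub>M\<^esub> (\<ominus>\<^bsub>R\<^esub> \<one>\<^bsub>R\<^esub> \<oplus>\<^bsub>R\<^esub> \<one>\<^bsub>R\<^esub>)"
      using a' by (simp add: ract_add_scalar ract_one)
    also have "\<dots> = \<zero>\<^bsub>M\<^esub>"
      using a' by (simp add: R.l_neg ract_zero)
    finally have "\<ominus>\<^bsub>M\<^esub> a = a \<bullet>\<^bsub>M\<^esub> (\<ominus>\<^bsub>R\<^esub> \<one>\<^bsub>R\<^esub>)"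
      using a' by (intro M.minus_equality) (auto intro: ract_closed)
    then show ?thesis
      using ract[OF a] by simp
  qed
  then show ?thesis
    using assms by (intro submodule.intro subgroup.intro submodule_axioms.intro)
      (auto simp flip: a_inv_def)
qed

lemma submodule_zero: "submodule {\<zero>\<^bsub>M\<^esub>} R M"
  by (rule submoduleI) (auto simp: zero_ract)

lemma submodule_carrier: "submodule (carrier M) R M"
  by (rule submoduleI) (auto simp: ract_closed)

end

lemma submodule_subset: "submodule N R M \<Longrightarrow> N \<subseteq> carrier M"
  using subgroup.subset[OF submodule.axioms(1)] by force

lemma submodule_zero_closed: "submodule N R M \<Longrightarrow> \<zero>\<^bsub>M\<^esub> \<in> N"
  using subgroup.one_closed[OF submodule.axioms(1)] by force

lemma submodule_add_closed: "submodule N R M \<Longrightarrow> a \<in> N \<Longrightarrow> b \<in> N \<Longrightarrow> a \<oplus>\<^bsub>M\<^esub> b \<in> N"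
  using subgroup.m_closed[OF submodule.axioms(1)] by force

lemma rspan_least: "submodule N R M \<Longrightarrow> S \<subseteq> N \<Longrightarrow> rspan R M S \<subseteq> N"
  by (auto simp: rspan_def)

lemma rspan_superset: "S \<subseteq> rspan R M S"
  by (auto simp: rspan_def)

lemma left_ann_antimono: "A \<subseteq> B \<Longrightarrow> left_ann M B \<subseteq> left_ann M A"
  by (auto simp: left_ann_def)

context right_module
begin

lemma submodule_rspan:
  assumes "S \<subseteq> carrier M"
  shows "submodule (rspan R M S) R M"
proof (rule submoduleI)
  show "rspan R M S \<subseteq> carrier M"
    using rspan_least[OF submodule_carrier assms] .
qed (auto simp: rspan_def submodule_zero_closed submodule_add_closed submodule.smult_closed)

text \<open>Closure under the right action uses that A absorbs multiplication from the left: (m r) a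
  = m (r a).\<close>

lemma submodule_left_ann:
  assumes "ideal A R"
  shows "submodule (left_ann M A) R M"
proof (rule submoduleI)
  fix m r assume m: "m \<in> left_ann M A" and r: "r \<in> carrier R"
  have "(m \<bullet>\<^bsub>M\<^esub> r) \<bullet>\<^bsub>M\<^esub> a = \<zero>\<^bsub>M\<^esub>" if "a \<in> A" for a
  proof -
    have "(m \<bullet>\<^bsub>M\<^esub> r) \<bullet>\<^bsub>M\<^esub> a = m \<bullet>\<^bsub>M\<^esub> (r \<otimes>\<^bsub>R\<^esub> a)"
      using m r that ideal.Icarr[OF assms] by (simp add: left_ann_def ract_assoc)
    then show ?thesis
      using m ideal.I_l_closed[OF assms that r] by (simp add: left_ann_def)
  qed
  then show "m \<bullet>\<^bsub>M\<^esub> r \<in> left_ann M A"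
    using m r by (simp add: left_ann_def ract_closed)
qed (use ideal.Icarr[OF assms] in \<open>auto simp: left_ann_def zero_ract ract_add\<close>)

text \<open>This turns the membership conditions of \<open>gamma_pre\<close> and
  \<open>rho_pre\<close> into m A = 0. One direction uses that m = m 1 lies in m R, the other that
  the elements killed by A form a submodule and so include all of m R.\<close>

lemma subset_right_ann_cyclic:
  assumes A: "ideal A R" and m: "m \<in> carrier M"
  shows "A \<subseteq> right_ann R M (cyclic_submodule R M m) \<longleftrightarrow> m \<in> left_ann M A"
proof
  assume *: "A \<subseteq> right_ann R M (cyclic_submodule R M m)"
  have "m \<in> cyclic_submodule R M m"
    using ract_one[OF m] unfolding cyclic_submodule_def by force
  then show "m \<in> left_ann M A"
    using * m by (auto simp: left_ann_def right_ann_def)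
next
  assume "m \<in> left_ann M A"
  then have "m \<bullet>\<^bsub>M\<^esub> r \<in> left_ann M A" if "r \<in> carrier R" for r
    using submodule.smult_closed[OF submodule_left_ann[OF A] that] by simp
  then show "A \<subseteq> right_ann R M (cyclic_submodule R M m)"
    using ideal.Icarr[OF A] by (auto simp: left_ann_def right_ann_def cyclic_submodule_def)
qed

text \<open>This is m (A B) = (m A) B: the product ideal consists of finite sums of products a b,
  and the action is associative and additive in the scalar.\<close>

lemma left_ann_ideal_prod:
  assumes A: "ideal A R" and B: "ideal B R" and m: "m \<in> carrier M"
  shows "m \<in> left_ann M (A \<cdot>\<^bsub>R\<^esub> B) \<longleftrightarrow> (\<forall>a\<in>A. m \<bullet>\<^bsub>M\<^esub> a \<in> left_ann M B)"
proof
  assume L: "m \<in> left_ann M (A \<cdot>\<^bsub>R\<^esub> B)"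
  show "\<forall>a\<in>A. m \<bullet>\<^bsub>M\<^esub> a \<in> left_ann M B"
  proof
    fix a assume a: "a \<in> A"
    have "(m \<bullet>\<^bsub>M\<^esub> a) \<bullet>\<^bsub>M\<^esub> b = \<zero>\<^bsub>M\<^esub>" if b: "b \<in> B" for b
    proof -
      have "m \<bullet>\<^bsub>M\<^esub> (a \<otimes>\<^bsub>R\<^esub> b) = \<zero>\<^bsub>M\<^esub>"
        using L ideal_prod.prod[OF a b, of R] by (simp add: left_ann_def)
      then show ?thesis
        using m a b ideal.Icarr[OF A] ideal.Icarr[OF B] by (simp add: ract_assoc)
    qed
    then show "m \<bullet>\<^bsub>M\<^esub> a \<in> left_ann M B"
      using m a ideal.Icarr[OF A] by (simp add: left_ann_def ract_closed)
  qed
next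
  assume L: "\<forall>a\<in>A. m \<bullet>\<^bsub>M\<^esub> a \<in> left_ann M B"
  \<comment> \<open>Membership in the carrier is carried through the induction because additivity of
    the action in the scalar requires it.\<close>
  have "x \<in> carrier R \<and> m \<bullet>\<^bsub>M\<^esub> x = \<zero>\<^bsub>M\<^esub>" if "x \<in> A \<cdot>\<^bsub>R\<^esub> B" for x
    using that
  proof induct
    case (prod a b)
    then show ?case
      using L m ideal.Icarr[OF A] ideal.Icarr[OF B] by (simp add: left_ann_def ract_assoc)
  next
    case (sum x y)
    then show ?case
      using m by (simp add: ract_add_scalar)
  qed
  then show "m \<in> left_ann M (A \<cdot>\<^bsub>R\<^esub> B)"
    using m by (simp add: left_ann_def)
qed

text \<open>With 1 = a + b, an element m killed by both ideals is m a + m b = 0.\<close>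

lemma left_ann_comaximal_disjoint:
  assumes A: "ideal A R" and B: "ideal B R" and AB: "A <+>\<^bsub>R\<^esub> B = carrier R"
  shows "left_ann M A \<inter> left_ann M B \<subseteq> {\<zero>\<^bsub>M\<^esub>}"
proof
  fix m assume m: "m \<in> left_ann M A \<inter> left_ann M B"
  obtain a b where ab: "a \<in> A" "b \<in> B" "\<one>\<^bsub>R\<^esub> = a \<oplus>\<^bsub>R\<^esub> b"
    using AB R.comaximal_iff[OF A B] by auto
  have "m = m \<bullet>\<^bsub>M\<^esub> (a \<oplus>\<^bsub>R\<^esub> b)"
    using m ab ract_one[of m] by (simp add: left_ann_def)
  also have "\<dots> = \<zero>\<^bsub>M\<^esub>"
    using m ab ideal.Icarr[OF A] ideal.Icarr[OF B] by (simp add: left_ann_def ract_add_scalar)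
  finally show "m \<in> {\<zero>\<^bsub>M\<^esub>}"
    by simp
qed

lemma left_ann_comaximal_Int:
  assumes A: "ideal A R" and B: "ideal B R" and AB: "A <+>\<^bsub>R\<^esub> B = carrier R"
    and m: "m \<in> left_ann M (A \<inter> B)"
  shows "\<exists>u\<in>left_ann M A. \<exists>v\<in>left_ann M B. m = u \<oplus>\<^bsub>M\<^esub> v"
proof -
  obtain a b where ab: "a \<in> A" "b \<in> B" "\<one>\<^bsub>R\<^esub> = a \<oplus>\<^bsub>R\<^esub> b"
    using AB R.comaximal_iff[OF A B] by auto
  have carr: "m \<in> carrier M" "a \<in> carrier R" "b \<in> carrier R"
    using m ab ideal.Icarr[OF A] ideal.Icarr[OF B] by (auto simp: left_ann_def)
  \<comment> \<open>Stated for C and D so that it serves both summands: m b is killed by A and m a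
    by B. The product x c lies in C by absorption from the left and in D by absorption from the
    right, hence in both A and B.\<close>
  have kill: "m \<bullet>\<^bsub>M\<^esub> x \<in> left_ann M C" if x: "x \<in> D" and CD: "ideal C R" "ideal D R" "C \<inter> D = A \<inter> B"
    for x C D
  proof -
    have "(m \<bullet>\<^bsub>M\<^esub> x) \<bullet>\<^bsub>M\<^esub> c = \<zero>\<^bsub>M\<^esub>" if c: "c \<in> C" for c
    proof -
      have xc: "x \<in> carrier R" "c \<in> carrier R"
        using x c CD by (auto intro: ideal.Icarr)
      have "x \<otimes>\<^bsub>R\<^esub> c \<in> A \<inter> B"
        using ideal.I_l_closed[OF CD(1) c xc(1)] ideal.I_r_closed[OF CD(2) x xc(2)] CD(3) by blast
      then have "m \<bullet>\<^bsub>M\<^esub> (x \<otimes>\<^bsub>R\<^esub> c) = \<zero>\<^bsub>M\<^esub>"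
        using m by (simp add: left_ann_def)
      then show ?thesis
        using carr xc by (simp add: ract_assoc)
    qed
    then show ?thesis
      using carr ideal.Icarr[OF CD(2) x] by (simp add: left_ann_def ract_closed)
  qed
  have "m = m \<bullet>\<^bsub>M\<^esub> b \<oplus>\<^bsub>M\<^esub> m \<bullet>\<^bsub>M\<^esub> a"
    using carr ab(3) by (metis M.a_comm ract_add_scalar ract_closed ract_one)
  then show ?thesis
    using kill[OF ab(2) A B] kill[OF ab(1) B A] by blast
qed

text \<open>The notion of radical only mentions modules isomorphic to the quotient. Composing the
  projection with the inverse isomorphism gives a surjection onto such a copy with kernel N, so
  later arguments never touch cosets.\<close>

lemma quotient_copy_hom:
  fixes Q :: "('r, 'm) module"
  assumes N: "submodule N R M" and Q: "right_module R Q"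
    and iso: "rmod_isomorphic R Q (quot_module M N)"
  shows "\<exists>g\<in>rmod_hom R M Q. g ` carrier M = carrier Q \<and>
    (\<forall>m\<in>carrier M. g m = \<zero>\<^bsub>Q\<^esub> \<longleftrightarrow> m \<in> N)"
proof -
  interpret N: abelian_subgroup N M
    using submodule_abelian_subgroup[OF N] .
  interpret Q: right_module R Q
    by (rule Q)
  obtain f where f: "f \<in> rmod_hom R Q (quot_module M N)"
    and bij: "bij_betw f (carrier Q) (a_rcosets\<^bsub>M\<^esub> N)"
    using iso by (auto simp: rmod_isomorphic_def quot_module_def)
  define g where "g m = the_inv_into (carrier Q) f (N +>\<^bsub>M\<^esub> m)" for m
  have inj: "inj_on f (carrier Q)"
    using bij by (simp add: bij_betw_def)
  have im: "f ` carrier Q = a_rcosets\<^bsub>M\<^esub> N"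
    using bij by (simp add: bij_betw_def)
  have f_add: "f (x \<oplus>\<^bsub>Q\<^esub> y) = f x <+>\<^bsub>M\<^esub> f y" if "x \<in> carrier Q" "y \<in> carrier Q" for x y
    using f that by (simp add: rmod_hom_def quot_module_def)
  have f_ract: "f (x \<bullet>\<^bsub>Q\<^esub> r) = (\<Union>m\<in>f x. N +>\<^bsub>M\<^esub> (m \<bullet>\<^bsub>M\<^esub> r))" if "x \<in> carrier Q" "r \<in> carrier R" for x r
    using f that by (simp add: rmod_hom_def quot_module_def)
  have coset: "N +>\<^bsub>M\<^esub> m \<in> f ` carrier Q" if "m \<in> carrier M" for m
    unfolding im using that N.a_subset by (intro M.a_rcosetsI)
  have gc: "g m \<in> carrier Q" if "m \<in> carrier M" for m
    unfolding g_def using the_inv_into_into[OF inj coset[OF that]] by simp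
  have fg: "f (g m) = N +>\<^bsub>M\<^esub> m" if "m \<in> carrier M" for m
    unfolding g_def using f_the_inv_into_f[OF inj coset[OF that]] .
  \<comment> \<open>Identities in Q are checked by applying the injective map f, which turns them
    into identities between cosets.\<close>
  have eq: "x = y" if "x \<in> carrier Q" "y \<in> carrier Q" "f x = f y" for x y
    using inj that by (auto dest: inj_onD)
  have hom: "g \<in> rmod_hom R M Q"
    unfolding rmod_hom_def
  proof (intro CollectI conjI ballI)
    show "g \<in> carrier M \<rightarrow> carrier Q"
      using gc by blast
    show "g (m \<oplus>\<^bsub>M\<^esub> m') = g m \<oplus>\<^bsub>Q\<^esub> g m'" if "m \<in> carrier M" "m' \<in> carrier M" for m m'
      using that by (intro eq) (simp_all add: gc fg f_add N.a_rcos_sum)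
    show "g (m \<bullet>\<^bsub>M\<^esub> r) = g m \<bullet>\<^bsub>Q\<^esub> r" if "m \<in> carrier M" "r \<in> carrier R" for m r
      using that by (intro eq) (simp_all add: gc fg f_ract ract_closed Q.ract_closed quot_ract[OF N])
  qed
  \<comment> \<open>Preservation of zero is not part of \<open>rmod_hom\<close>; it follows from
    compatibility with the action of the scalar 0.\<close>
  have g0: "g \<zero>\<^bsub>M\<^esub> = \<zero>\<^bsub>Q\<^esub>"
  proof -
    have "g \<zero>\<^bsub>M\<^esub> = g (\<zero>\<^bsub>M\<^esub> \<bullet>\<^bsub>M\<^esub> \<zero>\<^bsub>R\<^esub>)"
      by (simp add: ract_zero)
    also have "\<dots> = g \<zero>\<^bsub>M\<^esub> \<bullet>\<^bsub>Q\<^esub> \<zero>\<^bsub>R\<^esub>"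
      using hom by (simp add: rmod_hom_def)
    finally show ?thesis
      by (simp add: Q.ract_zero gc)
  qed
  show ?thesis
  proof (intro bexI[OF _ hom] conjI ballI)
    show "g ` carrier M = carrier Q"
    proof
      show "carrier Q \<subseteq> g ` carrier M"
      proof
        fix x assume x: "x \<in> carrier Q"
        then have "f x \<in> a_rcosets\<^bsub>M\<^esub> N"
          using im by blast
        then obtain m where m: "m \<in> carrier M" "f x = N +>\<^bsub>M\<^esub> m"
          by (auto simp: A_RCOSETS_def')
        then have "x = g m"
          using x by (intro eq) (simp_all add: gc fg)
        then show "x \<in> g ` carrier M"
          using m by blast
      qed
    qed (use gc in blast)
    show "g m = \<zero>\<^bsub>Q\<^esub> \<longleftrightarrow> m \<in> N" if m: "m \<in> carrier M" for m
    proof -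
      have "g m = g \<zero>\<^bsub>M\<^esub> \<longleftrightarrow> N +>\<^bsub>M\<^esub> m = N +>\<^bsub>M\<^esub> \<zero>\<^bsub>M\<^esub>"
        using m fg gc eq by (metis M.zero_closed)
      also have "N +>\<^bsub>M\<^esub> \<zero>\<^bsub>M\<^esub> = N"
        using M.a_coset_add_zero N.a_subset by blast
      also have "N +>\<^bsub>M\<^esub> m = N \<longleftrightarrow> m \<in> N"
        using m N.a_rcos_self N.a_rcos_const by blast
      finally show ?thesis
        by (simp add: g0)
    qed
  qed
qed

end

lemma (in ring) rmod_hom_left_ann:
  assumes M: "right_module R M" and N: "right_module R N" and f: "f \<in> rmod_hom R M N"
    and A: "A \<subseteq> carrier R" and m: "m \<in> left_ann M A"
  shows "f m \<in> left_ann N A"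
proof -
  interpret M: right_module R M
    by (rule M)
  interpret N: right_module R N
    by (rule N)
  have carr: "m \<in> carrier M" "f m \<in> carrier N"
    using f m by (auto simp: rmod_hom_def left_ann_def)
  have hom: "f (m \<bullet>\<^bsub>M\<^esub> a) = f m \<bullet>\<^bsub>N\<^esub> a" if "a \<in> carrier R" for a
    using f carr that by (simp add: rmod_hom_def)
  have "f \<zero>\<^bsub>M\<^esub> = \<zero>\<^bsub>N\<^esub>"
    using hom[of \<zero>] carr by (simp add: M.ract_zero N.ract_zero)
  moreover have "m \<bullet>\<^bsub>M\<^esub> a = \<zero>\<^bsub>M\<^esub>" if "a \<in> A" for a
    using m that by (simp add: left_ann_def)
  ultimately have "f m \<bullet>\<^bsub>N\<^esub> a = \<zero>\<^bsub>N\<^esub>" if "a \<in> A" for a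
    using hom[of a] A that by auto
  then show ?thesis
    using carr by (simp add: left_ann_def)
qed

section \<open>The preradical of a directed family of ideals\<close>

text \<open>Keeping the condition in terms of \<open>right_ann\<close> makes
  \<open>gamma_pre\<close> and \<open>rho_pre\<close> literal instances, for two different families
  F.\<close>

definition family_ann :: "('r, 'x) ring_scheme \<Rightarrow> 'r set set \<Rightarrow> ('r, 'm) submodule_assignment"
  where "family_ann R F M =
    {m \<in> carrier M. \<exists>A\<in>F. A \<subseteq> right_ann R M (cyclic_submodule R M m)}"

text \<open>The cyclic submodule of m and its annihilator are computed from the operations alone, so
  they are the same in N as in M. This holds for an arbitrary family F.\<close>

lemma left_exact_family_ann:
  fixes R :: "('r, 'x) ring_scheme"
  shows "left_exact R (family_ann R F :: ('r, 'm) submodule_assignment)"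
  unfolding left_exact_def
proof (intro allI impI)
  fix M :: "('r, 'm) module" and N
  assume "right_module R M \<and> submodule N R M"
  then have "N \<subseteq> carrier M"
    using submodule_subset by blast
  then show "family_ann R F (M\<lparr>carrier := N\<rparr>) = N \<inter> family_ann R F M"
    by (auto simp: family_ann_def right_ann_def cyclic_submodule_def)
qed

locale directed_ideals = ring R for R :: "('r, 'x) ring_scheme" (structure) +
  fixes F :: "'r set set"
  assumes nonempty: "F \<noteq> {}"
    and ideals: "A \<in> F \<Longrightarrow> ideal A R"
    and directed: "\<lbrakk>A \<in> F; B \<in> F\<rbrakk> \<Longrightarrow> \<exists>C\<in>F. C \<subseteq> A \<inter> B"
begin

lemma family_ann_eq:
  assumes "right_module R M"
  shows "family_ann R F M = (\<Union>A\<in>F. left_ann M A)"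
proof -
  have iff: "A \<subseteq> right_ann R M (cyclic_submodule R M m) \<longleftrightarrow> m \<in> left_ann M A"
    if "A \<in> F" "m \<in> carrier M" for A m
    using assms ideals[OF that(1)] that(2) by (rule right_module.subset_right_ann_cyclic)
  have "m \<in> family_ann R F M \<longleftrightarrow> (\<exists>A\<in>F. m \<in> left_ann M A)" for m
  proof (cases "m \<in> carrier M")
    case True
    then show ?thesis
      using iff by (simp add: family_ann_def)
  qed (simp add: family_ann_def left_ann_def)
  then show ?thesis
    by blast
qed

text \<open>A smaller ideal has a larger annihilator, so directedness of F makes the annihilators a
  directed family of submodules, and a directed union is closed under addition.\<close>

lemma submodule_family_ann:
  assumes "right_module R M"
  shows "submodule (family_ann R F M) R M"
proof -
  interpret M: right_module R M
    by (rule assms)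
  have sub: "submodule (left_ann M A) R M" if "A \<in> F" for A
    using ideals[OF that] by (rule M.submodule_left_ann)
  show ?thesis
  proof (rule M.submoduleI)
    show "family_ann R F M \<subseteq> carrier M"
      by (simp add: family_ann_def)
    show "\<zero>\<^bsub>M\<^esub> \<in> family_ann R F M"
      using nonempty submodule_zero_closed[OF sub] unfolding family_ann_eq[OF assms] by blast
    show "a \<bullet>\<^bsub>M\<^esub> r \<in> family_ann R F M" if "a \<in> family_ann R F M" "r \<in> carrier R" for a r
      using that submodule.smult_closed[OF sub] unfolding family_ann_eq[OF assms] by blast
    fix a b assume "a \<in> family_ann R F M" "b \<in> family_ann R F M"
    then obtain A B where AB: "A \<in> F" "B \<in> F" "a \<in> left_ann M A" "b \<in> left_ann M B"
      by (auto simp: family_ann_eq[OF assms])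
    obtain C where C: "C \<in> F" "C \<subseteq> A" "C \<subseteq> B"
      using directed[OF AB(1,2)] by auto
    have "a \<in> left_ann M C" "b \<in> left_ann M C"
      using AB(3,4) left_ann_antimono[OF C(2), of M] left_ann_antimono[OF C(3), of M] by auto
    then show "a \<oplus>\<^bsub>M\<^esub> b \<in> family_ann R F M"
      using C(1) submodule_add_closed[OF sub[OF C(1)]] unfolding family_ann_eq[OF assms] by blast
  qed
qed

lemma preradical_family_ann: "preradical R (family_ann R F)"
  unfolding preradical_def
proof (intro conjI allI impI)
  fix M N :: "('r, 'm) module" and f
  assume *: "right_module R M \<and> right_module R N \<and> f \<in> rmod_hom R M N"
  have "f m \<in> left_ann N A" if A: "A \<in> F" and m: "m \<in> left_ann M A" for m A
  proof (rule rmod_hom_left_ann[where f = f, OF _ _ _ _ m])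
    show "A \<subseteq> carrier R"
      using ideal.Icarr[OF ideals[OF A]] by (rule subsetI)
  qed (use * in auto)
  then show "f ` family_ann R F M \<subseteq> family_ann R F N"
    using * by (auto simp: family_ann_eq)
qed (rule submodule_family_ann)

text \<open>An element of the quotient killed by A lifts to some m with m A inside the preradical.
  The hypothesis then puts m itself inside, so the element of the quotient is zero.\<close>

lemma radical_family_annI:
  assumes closed: "\<And>M :: ('r, 'm) module. \<And>m A.
      \<lbrakk>right_module R M; A \<in> F; m \<in> carrier M; \<And>a. a \<in> A \<Longrightarrow> m \<bullet>\<^bsub>M\<^esub> a \<in> family_ann R F M\<rbrakk>
      \<Longrightarrow> m \<in> family_ann R F M"
  shows "radical R (family_ann R F :: ('r, 'm) submodule_assignment)"
  unfolding radical_def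
proof (intro conjI allI impI preradical_family_ann)
  fix M Q :: "('r, 'm) module"
  assume *: "right_module R M \<and> right_module R Q \<and>
    rmod_isomorphic R Q (quot_module M (family_ann R F M))"
  then interpret M: right_module R M
    by simp
  obtain g where g: "g \<in> rmod_hom R M Q" "g ` carrier M = carrier Q"
    "\<And>m. m \<in> carrier M \<Longrightarrow> g m = \<zero>\<^bsub>Q\<^esub> \<longleftrightarrow> m \<in> family_ann R F M"
    using M.quotient_copy_hom[of "family_ann R F M" Q] * submodule_family_ann[of M] by auto
  have "q = \<zero>\<^bsub>Q\<^esub>" if q: "q \<in> family_ann R F Q" for q
  proof -
    obtain A where A: "A \<in> F" "q \<in> left_ann Q A"
      using q * by (auto simp: family_ann_eq)
    then have "q \<in> g ` carrier M"
      using g(2) by (simp add: left_ann_def)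
    then obtain m where m: "m \<in> carrier M" "q = g m"
      by blast
    have "m \<bullet>\<^bsub>M\<^esub> a \<in> family_ann R F M" if a: "a \<in> A" for a
    proof -
      have a': "a \<in> carrier R"
        using ideals[OF A(1)] a by (rule ideal.Icarr)
      have "g (m \<bullet>\<^bsub>M\<^esub> a) = \<zero>\<^bsub>Q\<^esub>"
        using A(2) a a' m g(1) by (simp add: left_ann_def rmod_hom_def)
      then show ?thesis
        using g(3) M.ract_closed[OF m(1) a'] by simp
    qed
    then have "m \<in> family_ann R F M"
      using closed[OF M.right_module_axioms A(1) m(1)] by blast
    then show ?thesis
      using g(3) m by simp
  qed
  moreover have "\<zero>\<^bsub>Q\<^esub> \<in> family_ann R F Q"
    using * submodule_family_ann submodule_zero_closed by blast
  ultimately show "family_ann R F Q = {\<zero>\<^bsub>Q\<^esub>}"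
    by blast
qed

end

section \<open>Powers of a directed family and the radical property\<close>

definition pow_family :: "('r, 'x) ring_scheme \<Rightarrow> 'r set set \<Rightarrow> 'r set set"
  where "pow_family R F = {ideal_pow R A n | A n. A \<in> F \<and> 1 \<le> n}"

lemma right_module_regular:
  assumes "ring R"
  shows "right_module R (regular_module R)"
proof -
  interpret ring R
    by (rule assms)
  have "abelian_group (regular_module R)"
  proof (rule abelian_groupI)
    fix x assume "x \<in> carrier (regular_module R)"
    then show "\<exists>y\<in>carrier (regular_module R). y \<oplus>\<^bsub>regular_module R\<^esub> x = \<zero>\<^bsub>regular_module R\<^esub>"
      by (auto simp: regular_module_def l_neg intro: bexI[of _ "\<ominus>\<^bsub>R\<^esub> x"])
  qed (auto simp: regular_module_def a_ac)
  moreover have "right_module_axioms R (regular_module R)"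
    by unfold_locales (auto simp: regular_module_def l_distr r_distr m_assoc)
  ultimately show ?thesis
    by (intro right_module.intro ring_axioms)
qed

text \<open>As this set is a right ideal, m K inside N need only be tested on right ideal generators
  of K.\<close>

lemma (in right_module) submodule_preimage:
  assumes N: "submodule N R M" and m: "m \<in> carrier M"
  shows "submodule {r \<in> carrier R. m \<bullet>\<^bsub>M\<^esub> r \<in> N} R (regular_module R)"
proof -
  interpret Reg: right_module R "regular_module R"
    using R.ring_axioms by (rule right_module_regular)
  show ?thesis
    using N m
    by (intro Reg.submoduleI)
      (auto simp: regular_module_def ract_zero ract_add_scalar ract_assoc
        submodule_zero_closed submodule_add_closed submodule.smult_closed)
qed

context directed_ideals
begin

lemma directed_pow_family: "directed_ideals R (pow_family R F)"
proof (intro directed_ideals.intro directed_ideals_axioms.intro ring_axioms)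
  show "pow_family R F \<noteq> {}"
    using nonempty by (auto simp: pow_family_def)
  show "ideal A R" if "A \<in> pow_family R F" for A
    using that ideals ideal_ideal_pow by (auto simp: pow_family_def)
  fix A B assume "A \<in> pow_family R F" "B \<in> pow_family R F"
  then obtain C n D p where CD: "C \<in> F" "D \<in> F" "A = ideal_pow R C n" "B = ideal_pow R D p"
    "1 \<le> n" "1 \<le> p"
    by (auto simp: pow_family_def)
  obtain E where E: "E \<in> F" "E \<subseteq> C" "E \<subseteq> D"
    using directed[OF CD(1,2)] by auto
  \<comment> \<open>Below both bases E works; the larger exponent then makes the power small enough
    for both.\<close>
  have "ideal_pow R E (max n p) \<subseteq> A \<inter> B"
    using ideal_pow_antimono[OF ideals[OF E(1)], of n "max n p"]
      ideal_pow_antimono[OF ideals[OF E(1)], of p "max n p"]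
      ideal_pow_mono[OF E(2), of R n] ideal_pow_mono[OF E(3), of R p] CD(3,4) by auto
  moreover have "ideal_pow R E (max n p) \<in> pow_family R F"
    unfolding pow_family_def using E(1) CD(5) max.coboundedI1 by blast
  ultimately show "\<exists>E\<in>pow_family R F. E \<subseteq> A \<inter> B"
    by blast
qed

text \<open>If E lies in both bases C and D, then E^(n+p) = E^n E^p lies in the product of C^n and
  D^p. Passing to powers provides this, so an element killed by a product of two members is killed
  by a member.\<close>

lemma pow_family_prod:
  assumes "A \<in> pow_family R F" "B \<in> pow_family R F"
  shows "\<exists>C\<in>pow_family R F. C \<subseteq> A \<cdot> B"
proof -
  obtain C n D p where CD: "C \<in> F" "D \<in> F" "A = ideal_pow R C n" "B = ideal_pow R D p"
    "1 \<le> n" "1 \<le> p"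
    using assms by (auto simp: pow_family_def)
  obtain E where E: "E \<in> F" "E \<subseteq> C" "E \<subseteq> D"
    using directed[OF CD(1,2)] by auto
  have "ideal_pow R E (n + p) = ideal_pow R E n \<cdot> ideal_pow R E p"
    using ideals[OF E(1)] by (rule ideal_pow_add)
  also have "\<dots> \<subseteq> A \<cdot> B"
    unfolding CD(3,4) by (intro ideal_prod_mono ideal_pow_mono E)
  finally have "ideal_pow R E (n + p) \<subseteq> A \<cdot> B" .
  moreover have "ideal_pow R E (n + p) \<in> pow_family R F"
    unfolding pow_family_def using E(1) CD(5) trans_le_add1 by blast
  ultimately show ?thesis
    by blast
qed

lemma family_subset_pow_family: "F \<subseteq> pow_family R F"
  using ideals ideal_pow_1 by (fastforce simp: pow_family_def)

text \<open>Finitely many members of the family have a common lower bound in it, whose annihilator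
  contains all the given elements.\<close>

lemma left_ann_finite:
  assumes M: "right_module R M" and "finite S" "\<And>s. s \<in> S \<Longrightarrow> f s \<in> family_ann R F M"
  shows "\<exists>B\<in>F. \<forall>s\<in>S. f s \<in> left_ann M B"
  using assms(2,3)
proof (induct S rule: finite_induct)
  case empty
  then show ?case
    using nonempty by auto
next
  case (insert s S)
  obtain B where B: "B \<in> F" "\<forall>s\<in>S. f s \<in> left_ann M B"
    using insert by auto
  obtain C where C: "C \<in> F" "f s \<in> left_ann M C"
    using insert by (auto simp: family_ann_eq[OF M])
  obtain D where D: "D \<in> F" "D \<subseteq> B" "D \<subseteq> C"
    using directed[OF B(1) C(1)] by auto
  then show ?case
    using B(2) C(2) left_ann_antimono by (metis insert_iff subsetD)
qed

lemma radical_pow_family_fin_gen: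
  assumes fg: "\<And>A. A \<in> pow_family R F \<Longrightarrow> fin_gen_ideal R A"
  shows "radical R (family_ann R (pow_family R F) :: ('r, 'm) submodule_assignment)"
proof -
  interpret P: directed_ideals R "pow_family R F"
    by (rule directed_pow_family)
  show ?thesis
  proof (rule P.radical_family_annI)
    fix M :: "('r, 'm) module" and m A
    assume M: "right_module R M" and A: "A \<in> pow_family R F" and m: "m \<in> carrier M"
      and mA: "\<And>a. a \<in> A \<Longrightarrow> m \<bullet>\<^bsub>M\<^esub> a \<in> family_ann R (pow_family R F) M"
    interpret M: right_module R M
      by (rule M)
    obtain S where S: "finite S" "S \<subseteq> carrier R" "A = rspan R (regular_module R) S"
      using fg[OF A] by (auto simp: fin_gen_ideal_def)
    have "S \<subseteq> A"
      unfolding S(3) by (rule rspan_superset)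
    then obtain B where B: "B \<in> pow_family R F" "\<forall>s\<in>S. m \<bullet>\<^bsub>M\<^esub> s \<in> left_ann M B"
      using P.left_ann_finite[OF M S(1), of "\<lambda>s. m \<bullet>\<^bsub>M\<^esub> s"] mA by blast
    \<comment> \<open>The right-hand side is a right ideal containing the generators S, hence
      contains the right ideal A they span.\<close>
    have "A \<subseteq> {r \<in> carrier R. m \<bullet>\<^bsub>M\<^esub> r \<in> left_ann M B}"
      unfolding S(3)
      by (rule rspan_least[OF M.submodule_preimage[OF M.submodule_left_ann[OF P.ideals[OF B(1)]] m]])
        (use B(2) S(2) in blast)
    then have L: "m \<in> left_ann M (A \<cdot> B)"
      by (subst M.left_ann_ideal_prod[OF P.ideals[OF A] P.ideals[OF B(1)] m]) auto
    obtain C where C: "C \<in> pow_family R F" "C \<subseteq> A \<cdot> B"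
      using pow_family_prod[OF A B(1)] by blast
    show "m \<in> family_ann R (pow_family R F) M"
      using L C(1) left_ann_antimono[OF C(2), of M] unfolding P.family_ann_eq[OF M] by blast
  qed
qed

text \<open>Being least, E has the largest annihilator, so the preradical is the annihilator of E.
  If m A lies in it, so does m E, and then m E = m E E = 0.\<close>

lemma radical_pow_family_idempotent:
  assumes E: "E \<in> pow_family R F" "E \<cdot> E = E"
    and least: "\<And>A. A \<in> pow_family R F \<Longrightarrow> E \<subseteq> A"
  shows "radical R (family_ann R (pow_family R F) :: ('r, 'm) submodule_assignment)"
proof -
  interpret P: directed_ideals R "pow_family R F"
    by (rule directed_pow_family)
  have ann: "family_ann R (pow_family R F) M = left_ann M E"
    if "right_module R M" for M :: "('r, 'm) module"
    using E(1) left_ann_antimono[OF least, of _ M] unfolding P.family_ann_eq[OF that] by blast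
  show ?thesis
  proof (rule P.radical_family_annI)
    fix M :: "('r, 'm) module" and m A
    assume M: "right_module R M" and A: "A \<in> pow_family R F" and m: "m \<in> carrier M"
      and mA: "\<And>a. a \<in> A \<Longrightarrow> m \<bullet>\<^bsub>M\<^esub> a \<in> family_ann R (pow_family R F) M"
    interpret M: right_module R M
      by (rule M)
    have "m \<in> left_ann M (E \<cdot> E)"
      using M.left_ann_ideal_prod[OF P.ideals[OF E(1)] P.ideals[OF E(1)] m] mA least[OF A]
      unfolding ann[OF M] by blast
    then show "m \<in> family_ann R (pow_family R F) M"
      by (simp add: ann[OF M] E(2))
  qed
qed

text \<open>
  If \<open>m A\<^sup>n\<^sup>+\<^sup>1 = 0\<close>, then \<open>m A\<close> lies in \<open>\<tau> M\<close> by induction, so the image of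
  \<open>m\<close> in \<open>M / \<tau> M\<close> is killed by \<open>A\<close> and hence vanishes.
\<close>

lemma left_ann_ideal_pow_subset_radical:
  fixes M :: "('r, 'm) module"
  assumes rad: "radical R \<tau>" and le: "preradical_le R (family_ann R F) \<tau>"
    and M: "right_module R M" and A: "A \<in> F"
  shows "left_ann M (ideal_pow R A n) \<subseteq> \<tau> M"
proof (induct n)
  case 0
  interpret M: right_module R M
    by (rule M)
  have "m = \<zero>\<^bsub>M\<^esub>" if "m \<in> left_ann M (carrier R)" for m
    using that M.ract_one[of m] by (auto simp: left_ann_def)
  moreover have "submodule (\<tau> M) R M"
    using rad M by (simp add: radical_def preradical_def)
  ultimately show ?case
    using submodule_zero_closed by (auto simp: ideal_pow_0)
next
  case (Suc n)
  interpret M: right_module R M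
    by (rule M)
  have sub: "submodule (\<tau> M) R M"
    using rad M by (simp add: radical_def preradical_def)
  \<comment> \<open>The assignment \<tau> accepts only modules over the type \<open>'m\<close>, so a
    copy of the quotient in that type is chosen.\<close>
  obtain Q :: "('r, 'm) module"
    where Q: "right_module R Q" "rmod_isomorphic R Q (quot_module M (\<tau> M))"
    using M.ex_quotient_copy[OF sub] by auto
  then have Q0: "\<tau> Q = {\<zero>\<^bsub>Q\<^esub>}"
    using rad M unfolding radical_def by blast
  obtain g where g: "g \<in> rmod_hom R M Q"
    and g0: "\<And>m. m \<in> carrier M \<Longrightarrow> g m = \<zero>\<^bsub>Q\<^esub> \<longleftrightarrow> m \<in> \<tau> M"
    using M.quotient_copy_hom[OF sub Q] by blast
  have idA: "ideal A R"
    using A by (rule ideals)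
  show ?case
  proof
    fix m assume L: "m \<in> left_ann M (ideal_pow R A (Suc n))"
    then have m: "m \<in> carrier M"
      by (simp add: left_ann_def)
    \<comment> \<open>The recursion splits off the last factor; here the first is needed, so that m
      A is killed by the n-th power.\<close>
    have "ideal_pow R A (Suc n) = A \<cdot> ideal_pow R A n"
      using ideal_pow_add[OF idA, of "Suc 0" n] by (simp add: ideal_pow_1[OF idA])
    then have mA: "m \<bullet>\<^bsub>M\<^esub> a \<in> \<tau> M" if "a \<in> A" for a
      using L M.left_ann_ideal_prod[OF idA ideal_ideal_pow[OF idA] m] that Suc by auto
    have "g m \<bullet>\<^bsub>Q\<^esub> a = \<zero>\<^bsub>Q\<^esub>" if a: "a \<in> A" for a
    proof -
      have a': "a \<in> carrier R"
        using idA a by (rule ideal.Icarr)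
      then have "g m \<bullet>\<^bsub>Q\<^esub> a = g (m \<bullet>\<^bsub>M\<^esub> a)"
        using g m by (simp add: rmod_hom_def)
      then show ?thesis
        using g0[OF M.ract_closed[OF m a']] mA[OF a] by simp
    qed
    moreover have "g m \<in> carrier Q"
      using g m by (auto simp: rmod_hom_def)
    ultimately have "g m \<in> family_ann R F Q"
      using A by (auto simp: family_ann_eq[OF Q(1)] left_ann_def)
    then have "g m = \<zero>\<^bsub>Q\<^esub>"
      using le Q(1) Q0 unfolding preradical_le_def by blast
    then show "m \<in> \<tau> M"
      using g0 m by simp
  qed
qed

lemma radical_closure_family_ann:
  assumes "radical R (family_ann R (pow_family R F) :: ('r, 'm) submodule_assignment)"
  shows "is_radical_closure R (family_ann R F :: ('r, 'm) submodule_assignment)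
    (family_ann R (pow_family R F))"
  unfolding is_radical_closure_def
proof (intro conjI allI impI assms)
  show "preradical_le R (family_ann R F) (family_ann R (pow_family R F))"
    using family_subset_pow_family by (auto simp: preradical_le_def family_ann_def)
  fix \<tau> :: "('r, 'm) submodule_assignment"
  assume "radical R \<tau> \<and> preradical_le R (family_ann R F) \<tau>"
  then have "left_ann M (ideal_pow R A n) \<subseteq> \<tau> M" if "right_module R M" "A \<in> F" for A n
    and M :: "('r, 'm) module"
    using left_ann_ideal_pow_subset_radical[of \<tau> M A n] that by simp
  then show "preradical_le R (family_ann R (pow_family R F)) \<tau>"
    using directed_ideals.family_ann_eq[OF directed_pow_family]
    by (fastforce simp: preradical_le_def pow_family_def)
qed

end

section \<open>Comaximal families\<close>

definition inter_family :: "('r, 'x) ring_scheme \<Rightarrow> 'i set \<Rightarrow> ('i \<Rightarrow> 'r set) \<Rightarrow> 'r set set"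
  where "inter_family R I X =
    {inter_pow R X J k | J k. finite J \<and> J \<noteq> {} \<and> J \<subseteq> I \<and> (\<forall>i\<in>J. 1 \<le> k i)}"

lemma gamma_pre_eq: "gamma_pre R I X = family_ann R (inter_family R I X)"
  by (rule ext) (auto simp: gamma_pre_def family_ann_def inter_family_def)

lemma rho_pre_eq: "rho_pre R I X = family_ann R (pow_family R (inter_family R I X))"
  unfolding rho_pre_def family_ann_def pow_family_def inter_family_def by (rule ext) blast

lemma (in ring) directed_inter_family:
  assumes I: "I \<noteq> {}" and X: "\<forall>i\<in>I. ideal (X i) R"
  shows "directed_ideals R (inter_family R I X)"
proof (intro directed_ideals.intro directed_ideals_axioms.intro ring_axioms)
  obtain i where "i \<in> I"
    using I by blast
  then have "inter_pow R X {i} (\<lambda>_. 1) \<in> inter_family R I X"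
    unfolding inter_family_def by blast
  then show "inter_family R I X \<noteq> {}"
    by blast
  show "ideal A R" if "A \<in> inter_family R I X" for A
    using that X by (auto simp: inter_family_def intro!: ideal_inter_pow)
  fix A B assume "A \<in> inter_family R I X" "B \<in> inter_family R I X"
  then obtain J k K l where A: "A = inter_pow R X J k" "finite J" "J \<noteq> {}" "J \<subseteq> I" "\<forall>i\<in>J. 1 \<le> k i"
    and B: "B = inter_pow R X K l" "finite K" "K \<noteq> {}" "K \<subseteq> I" "\<forall>i\<in>K. 1 \<le> l i"
    by (auto simp: inter_family_def)
  \<comment> \<open>The exponent dominates k and l at every index, so the intersection over the
    union of J and K lies in both A and B; the outer \<open>max 1\<close> gives positivity without
    cases.\<close>
  define p where "p i = max 1 (max (k i) (l i))" for i
  have le: "ideal_pow R (X i) (p i) \<subseteq> ideal_pow R (X i) (k i)"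
    "ideal_pow R (X i) (p i) \<subseteq> ideal_pow R (X i) (l i)" if "i \<in> I" for i
    using ideal_pow_antimono[OF bspec[OF X that]] by (simp_all add: p_def)
  have "inter_pow R X (J \<union> K) p \<subseteq> A"
    unfolding A(1) inter_pow_def using A(4) by (intro INF_superset_mono le) auto
  moreover have "inter_pow R X (J \<union> K) p \<subseteq> B"
    unfolding B(1) inter_pow_def using B(4) by (intro INF_superset_mono le) auto
  ultimately have "inter_pow R X (J \<union> K) p \<subseteq> A \<inter> B"
    by blast
  moreover have "\<forall>i\<in>J \<union> K. 1 \<le> p i"
    by (simp add: p_def)
  then have "inter_pow R X (J \<union> K) p \<in> inter_family R I X"
    using A(2-4) B(2-4) unfolding inter_family_def by blast
  ultimately show "\<exists>C\<in>inter_family R I X. C \<subseteq> A \<inter> B"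
    by blast
qed

section \<open>Components and the direct sum decomposition\<close>

context right_module
begin

lemma submodule_gamma_pre:
  assumes "I \<noteq> {}" "\<forall>i\<in>I. ideal (X i) R"
  shows "submodule (gamma_pre R I X M) R M"
  unfolding gamma_pre_eq using assms
  by (intro directed_ideals.submodule_family_ann R.directed_inter_family right_module_axioms)

lemma gamma_pre_iff:
  assumes "I \<noteq> {}" "\<forall>i\<in>I. ideal (X i) R"
  shows "m \<in> gamma_pre R I X M \<longleftrightarrow>
    (\<exists>J k. finite J \<and> J \<noteq> {} \<and> J \<subseteq> I \<and> (\<forall>i\<in>J. 1 \<le> k i) \<and> m \<in> left_ann M (inter_pow R X J k))"
proof -
  have "gamma_pre R I X M = (\<Union>A\<in>inter_family R I X. left_ann M A)"
    unfolding gamma_pre_eq using assms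
    by (intro directed_ideals.family_ann_eq R.directed_inter_family right_module_axioms)
  then have "m \<in> gamma_pre R I X M \<longleftrightarrow> (\<exists>A\<in>inter_family R I X. m \<in> left_ann M A)"
    by simp
  then show ?thesis
    unfolding inter_family_def Bex_def mem_Collect_eq by metis
qed

text \<open>For one index the preradical is the union of the increasing chain of annihilators of
  powers. It is already a submodule, so it equals their sum, and an element of the component is
  killed by a single power.\<close>

lemma component_eq_gamma_pre:
  assumes "ideal (X i) R"
  shows "component R M (X i) = gamma_pre R {i} X M"
proof
  have iff: "m \<in> gamma_pre R {i} X M \<longleftrightarrow> (\<exists>k\<ge>1. m \<in> left_ann M (ideal_pow R (X i) k))" for m
  proof
    assume "m \<in> gamma_pre R {i} X M"
    then show "\<exists>k\<ge>1. m \<in> left_ann M (ideal_pow R (X i) k)"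
      using assms by (subst (asm) gamma_pre_iff) (auto simp: inter_pow_def subset_singleton_iff)
  next
    assume "\<exists>k\<ge>1. m \<in> left_ann M (ideal_pow R (X i) k)"
    then obtain k :: nat where "1 \<le> k" "m \<in> left_ann M (ideal_pow R (X i) k)"
      by blast
    then show "m \<in> gamma_pre R {i} X M"
      using assms by (subst gamma_pre_iff)
        (auto simp: inter_pow_def intro!: exI[of _ "{i}"] exI[of _ "\<lambda>_. k"])
  qed
  show "component R M (X i) \<subseteq> gamma_pre R {i} X M"
    unfolding component_def submodule_sum_def
    using iff assms by (intro rspan_least submodule_gamma_pre) auto
  show "gamma_pre R {i} X M \<subseteq> component R M (X i)"
    unfolding component_def submodule_sum_def
    using iff rspan_superset[of "\<Union>k\<in>{k. 1 \<le> k}. left_ann M (ideal_pow R (X i) k)" R M] by auto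
qed

lemma gamma_pre_mono:
  assumes "I \<subseteq> I'"
  shows "gamma_pre R I X M \<subseteq> gamma_pre R I' X M"
proof -
  have "inter_family R I X \<subseteq> inter_family R I' X"
    unfolding inter_family_def using assms subset_trans by blast
  then show ?thesis
    by (auto simp: gamma_pre_eq family_ann_def)
qed

lemma left_ann_pow_subset_component:
  assumes "1 \<le> k"
  shows "left_ann M (ideal_pow R X k) \<subseteq> component R M X"
  unfolding component_def submodule_sum_def
  using assms rspan_superset[of "\<Union>k\<in>{k. 1 \<le> k}. left_ann M (ideal_pow R X k)" R M] by blast

lemma submodule_sum_component_subset_gamma_pre:
  assumes "I \<noteq> {}" "\<forall>i\<in>I. ideal (X i) R"
  shows "submodule_sum R M I (\<lambda>i. component R M (X i)) \<subseteq> gamma_pre R I X M"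
  unfolding submodule_sum_def
proof (rule rspan_least[OF submodule_gamma_pre[OF assms]])
  have "component R M (X i) \<subseteq> gamma_pre R I X M" if "i \<in> I" for i
    unfolding component_eq_gamma_pre[where X = X, OF bspec[OF assms(2) that]]
    using that by (intro gamma_pre_mono) simp
  then show "(\<Union>i\<in>I. component R M (X i)) \<subseteq> gamma_pre R I X M"
    by blast
qed

text \<open>Induction on J, splitting off one power and applying
  \<open>left_ann_comaximal_Int\<close>. The target N is a fixed submodule, so sums of components
  over different index sets need not be compared.\<close>

lemma left_ann_inter_pow_subset:
  assumes N: "submodule N R M" and comp: "\<And>i. i \<in> J \<Longrightarrow> component R M (X i) \<subseteq> N"
    and J: "finite J" "J \<noteq> {}" and X: "\<And>i. i \<in> J \<Longrightarrow> ideal (X i) R"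
    and k: "\<And>i. i \<in> J \<Longrightarrow> 1 \<le> k i" and comax: "pairwise_comaximal R J X"
  shows "left_ann M (inter_pow R X J k) \<subseteq> N"
  using J comp X k comax
proof (induct J rule: finite_ne_induct)
  case (singleton i)
  then show ?case
    using left_ann_pow_subset_component[of "k i" "X i"] by (auto simp: inter_pow_def)
next
  case (insert i J)
  let ?A = "ideal_pow R (X i) (k i)" and ?B = "inter_pow R X J k"
  have A: "ideal ?A R"
    using insert by (simp add: R.ideal_ideal_pow)
  have B: "ideal ?B R"
    using insert by (simp add: R.ideal_inter_pow)
  have "?A <+>\<^bsub>R\<^esub> X j = carrier R" if j: "j \<in> J" for j
  proof -
    have "X i <+>\<^bsub>R\<^esub> X j = carrier R"
      using insert j by (auto simp: pairwise_comaximal_def)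
    then show ?thesis
      using R.comaximal_pow_pow[of "X i" "X j" "k i" 1] insert.prems(2) j
      by (simp add: R.ideal_pow_1)
  qed
  then have AB: "?A <+>\<^bsub>R\<^esub> ?B = carrier R"
    using insert A by (intro R.comaximal_inter_pow) auto
  have "left_ann M ?A \<subseteq> N"
    using left_ann_pow_subset_component[of "k i" "X i"] insert.prems by blast
  moreover have "left_ann M ?B \<subseteq> N"
    using insert.prems by (intro insert.hyps) (auto simp: pairwise_comaximal_def)
  ultimately have "left_ann M (?A \<inter> ?B) \<subseteq> N"
    using left_ann_comaximal_Int[OF A B AB] submodule_add_closed[OF N] by blast
  then show ?case
    by (simp add: inter_pow_def)
qed

lemma gamma_pre_eq_submodule_sum:
  assumes I: "I \<noteq> {}" and X: "\<forall>i\<in>I. ideal (X i) R" and comax: "pairwise_comaximal R I X"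
  shows "gamma_pre R I X M = submodule_sum R M I (\<lambda>i. component R M (X i))"
proof
  let ?S = "submodule_sum R M I (\<lambda>i. component R M (X i))"
  have comp: "component R M (X i) \<subseteq> carrier M" if "i \<in> I" for i
    by (auto simp: component_eq_gamma_pre[where X = X, OF bspec[OF X that]] gamma_pre_def)
  have sub: "submodule ?S R M"
    unfolding submodule_sum_def using comp by (intro submodule_rspan) blast
  have comp_S: "component R M (X i) \<subseteq> ?S" if "i \<in> I" for i
    unfolding submodule_sum_def using that rspan_superset[of "\<Union>i\<in>I. component R M (X i)" R M] by blast
  show "gamma_pre R I X M \<subseteq> ?S"
  proof
    fix m assume "m \<in> gamma_pre R I X M"
    then obtain J k where J: "finite J" "J \<noteq> {}" "J \<subseteq> I" "\<forall>i\<in>J. 1 \<le> k i"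
      and m: "m \<in> left_ann M (inter_pow R X J k)"
      unfolding gamma_pre_iff[OF I X] by (elim exE conjE)
    have "pairwise_comaximal R J X"
      using comax J(3) unfolding pairwise_comaximal_def by blast
    then have "left_ann M (inter_pow R X J k) \<subseteq> ?S"
      using J comp_S X by (intro left_ann_inter_pow_subset[OF sub]) auto
    then show "m \<in> ?S"
      using m by blast
  qed
  show "?S \<subseteq> gamma_pre R I X M"
    using I X by (rule submodule_sum_component_subset_gamma_pre)
qed

text \<open>Such an element is killed by a power of \<open>X i\<close> and by an intersection of
  powers of finitely many other members. These two ideals are comaximal, so it vanishes.\<close>

lemma component_Int_submodule_sum:
  assumes X: "\<forall>i\<in>I. ideal (X i) R" and comax: "pairwise_comaximal R I X" and i: "i \<in> I"
  shows "component R M (X i) \<inter> submodule_sum R M (I - {i}) (\<lambda>i. component R M (X i)) \<subseteq> {\<zero>\<^bsub>M\<^esub>}"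
proof (cases "I - {i} = {}")
  \<comment> \<open>With i the only index the sum is the span of the empty set, which is zero. This
    case stands apart because \<open>gamma_pre\<close> over no indices is the empty set rather than
    a submodule.\<close>
  case True
  then show ?thesis
    using rspan_least[OF submodule_zero, of "{}"] unfolding submodule_sum_def True by auto
next
  case False
  have X': "\<forall>j\<in>I - {i}. ideal (X j) R"
    using X by blast
  show ?thesis
  proof
    fix m
    assume m: "m \<in> component R M (X i) \<inter> submodule_sum R M (I - {i}) (\<lambda>i. component R M (X i))"
    then have "m \<in> gamma_pre R {i} X M"
      using component_eq_gamma_pre[of X i] bspec[OF X i] by blast
    then obtain k where k: "m \<in> left_ann M (ideal_pow R (X i) k)"
      using bspec[OF X i] by (subst (asm) gamma_pre_iff) (auto simp: inter_pow_def subset_singleton_iff)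
    have "m \<in> gamma_pre R (I - {i}) X M"
      using m submodule_sum_component_subset_gamma_pre[OF False X'] by blast
    then obtain J l where J: "finite J" "J \<noteq> {}" "J \<subseteq> I - {i}" "m \<in> left_ann M (inter_pow R X J l)"
      unfolding gamma_pre_iff[OF False X'] by (elim exE conjE)
    have idJ: "ideal (X j) R" if "j \<in> J" for j
      using X J(3) that by blast
    have "ideal_pow R (X i) k <+>\<^bsub>R\<^esub> X j = carrier R" if j: "j \<in> J" for j
    proof -
      have "j \<in> I" "i \<noteq> j"
        using j J(3) by auto
      then have "X i <+>\<^bsub>R\<^esub> X j = carrier R"
        using comax i by (simp add: pairwise_comaximal_def)
      then show ?thesis
        using R.comaximal_pow_pow[OF bspec[OF X i] idJ[OF j], of k 1] idJ[OF j]
        by (simp add: R.ideal_pow_1)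
    qed
    then have comax': "ideal_pow R (X i) k <+>\<^bsub>R\<^esub> inter_pow R X J l = carrier R"
      using J(1,2) idJ bspec[OF X i] by (intro R.comaximal_inter_pow R.ideal_ideal_pow) auto
    have "ideal (inter_pow R X J l) R"
      using J(1,2) idJ by (rule R.ideal_inter_pow)
    then show "m \<in> {\<zero>\<^bsub>M\<^esub>}"
      using left_ann_comaximal_disjoint[OF R.ideal_ideal_pow[OF bspec[OF X i]] _ comax'] k J(4) by blast
  qed
qed

lemma internal_direct_sum_gamma_pre:
  assumes I: "I \<noteq> {}" and X: "\<forall>i\<in>I. ideal (X i) R" and comax: "pairwise_comaximal R I X"
  shows "internal_direct_sum R M I (\<lambda>i. component R M (X i)) (gamma_pre R I X M)"
  unfolding internal_direct_sum_def
proof (intro conjI ballI)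
  show sub: "submodule (component R M (X i)) R M" if "i \<in> I" for i
    using bspec[OF X that] component_eq_gamma_pre[of X i] submodule_gamma_pre[of "{i}" X] by simp
  show "gamma_pre R I X M = submodule_sum R M I (\<lambda>i. component R M (X i))"
    using assms by (rule gamma_pre_eq_submodule_sum)
  fix i assume i: "i \<in> I"
  have "(\<Union>j\<in>I - {i}. component R M (X j)) \<subseteq> carrier M"
    using submodule_subset[OF sub] by blast
  then have "\<zero>\<^bsub>M\<^esub> \<in> submodule_sum R M (I - {i}) (\<lambda>i. component R M (X i))"
    unfolding submodule_sum_def by (intro submodule_zero_closed[OF submodule_rspan])
  moreover have "\<zero>\<^bsub>M\<^esub> \<in> component R M (X i)"
    using sub[OF i] by (rule submodule_zero_closed)
  ultimately show "component R M (X i) \<inter> submodule_sum R M (I - {i}) (\<lambda>i. component R M (X i)) = {\<zero>\<^bsub>M\<^esub>}"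
    using component_Int_submodule_sum[OF X comax i] by blast
qed

lemma gamma_pre_eq_zero_iff:
  assumes I: "I \<noteq> {}" and X: "\<forall>i\<in>I. ideal (X i) R" and comax: "pairwise_comaximal R I X"
  shows "gamma_pre R I X M = {\<zero>\<^bsub>M\<^esub>} \<longleftrightarrow>
    (\<forall>i\<in>I. \<forall>k::nat. 1 \<le> k \<longrightarrow> left_ann M (ideal_pow R (X i) k) = {\<zero>\<^bsub>M\<^esub>})"
proof
  assume zero: "gamma_pre R I X M = {\<zero>\<^bsub>M\<^esub>}"
  show "\<forall>i\<in>I. \<forall>k::nat. 1 \<le> k \<longrightarrow> left_ann M (ideal_pow R (X i) k) = {\<zero>\<^bsub>M\<^esub>}"
  proof (intro ballI allI impI)
    fix i and k :: nat assume i: "i \<in> I" and k: "1 \<le> k"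
    have "left_ann M (ideal_pow R (X i) k) \<subseteq> gamma_pre R {i} X M"
      using left_ann_pow_subset_component[OF k] component_eq_gamma_pre[of X i, OF bspec[OF X i]] by metis
    also have "\<dots> \<subseteq> gamma_pre R I X M"
      using i by (intro gamma_pre_mono) simp
    finally show "left_ann M (ideal_pow R (X i) k) = {\<zero>\<^bsub>M\<^esub>}"
      using zero submodule_zero_closed[OF submodule_left_ann[OF R.ideal_ideal_pow[OF bspec[OF X i]]]] by blast
  qed
next
  assume zero: "\<forall>i\<in>I. \<forall>k::nat. 1 \<le> k \<longrightarrow> left_ann M (ideal_pow R (X i) k) = {\<zero>\<^bsub>M\<^esub>}"
  \<comment> \<open>A sum of zero submodules is zero; this is used first over the exponents and then
    over the indices.\<close>
  have "component R M (X i) \<subseteq> {\<zero>\<^bsub>M\<^esub>}" if "i \<in> I" for i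
    unfolding component_def submodule_sum_def
    using zero that by (intro rspan_least submodule_zero) auto
  then have "submodule_sum R M I (\<lambda>i. component R M (X i)) \<subseteq> {\<zero>\<^bsub>M\<^esub>}"
    unfolding submodule_sum_def by (intro rspan_least submodule_zero) blast
  then show "gamma_pre R I X M = {\<zero>\<^bsub>M\<^esub>}"
    using gamma_pre_eq_submodule_sum[OF assms]
      submodule_zero_closed[OF submodule_gamma_pre[OF I X]] by blast
qed

end

text \<open>
  With \<open>D\<close> the intersection of the ideals \<open>X i\<close>, a power of \<open>D\<close> that is stationary is
  idempotent, and it is contained in every finite intersection of powers of the \<open>X i\<close>
  because \<open>D\<^sup>k \<subseteq> X i\<^sup>k\<close>.
\<close>

lemma (in ring) inter_family_least_power:
  assumes I: "finite I" "I \<noteq> {}" and X: "\<forall>i\<in>I. ideal (X i) R"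
    and n: "1 \<le> n" "ideal_pow R (inter_pow R X I (\<lambda>_. 1)) n =
      ideal_pow R (inter_pow R X I (\<lambda>_. 1)) (n + 1)"
  defines "E \<equiv> ideal_pow R (inter_pow R X I (\<lambda>_. 1)) n"
  shows "E \<in> pow_family R (inter_family R I X)" "E \<cdot> E = E"
    "\<And>A. A \<in> pow_family R (inter_family R I X) \<Longrightarrow> E \<subseteq> A"
proof -
  let ?D = "inter_pow R X I (\<lambda>_. 1)"
  have D: "ideal ?D R"
    using I X by (intro ideal_inter_pow) auto
  have stable: "ideal_pow R ?D (n + p) = E" for p
    unfolding E_def using D n(2) by (rule ideal_pow_stable)
  show EE: "E \<cdot> E = E"
    using stable[of n] ideal_pow_add[OF D, of n n] by (simp add: E_def)
  have "?D \<in> inter_family R I X"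
    using I unfolding inter_family_def by fastforce
  then show "E \<in> pow_family R (inter_family R I X)"
    unfolding pow_family_def E_def using n(1) by blast
  have E: "ideal E R"
    unfolding E_def using D by (rule ideal_ideal_pow)
  \<comment> \<open>Idempotence keeps E inside each of its powers, so once E lies in an intersection
    of powers it also lies in every power of that intersection.\<close>
  have E_pow: "E \<subseteq> ideal_pow R E p" for p
  proof (induct p)
    case (Suc p)
    then have "E \<cdot> E \<subseteq> ideal_pow R E (Suc p)"
      by (simp add: ideal_pow_Suc ideal_prod_mono)
    then show ?case
      by (simp add: EE)
  qed (use ideal.Icarr[OF E] in \<open>auto simp: ideal_pow_0\<close>)
  \<comment> \<open>The exponent n + p serves two ends: it is at least n, so that power of the
    intersection is still E, and at least p, so that power of \<open>X i\<close> lies in the p-th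
    one.\<close>
  have E_le: "E \<subseteq> ideal_pow R (X i) p" if "i \<in> I" for i p
  proof -
    have "?D \<subseteq> X i"
      using that X by (auto simp: inter_pow_def ideal_pow_1)
    then have "ideal_pow R ?D (n + p) \<subseteq> ideal_pow R (X i) (n + p)"
      by (rule ideal_pow_mono)
    also have "\<dots> \<subseteq> ideal_pow R (X i) p"
      using bspec[OF X that] by (intro ideal_pow_antimono) simp_all
    finally show ?thesis
      by (simp only: stable)
  qed
  fix A assume "A \<in> pow_family R (inter_family R I X)"
  then obtain J k p where A: "J \<subseteq> I" "A = ideal_pow R (inter_pow R X J k) p"
    by (auto simp: pow_family_def inter_family_def)
  have "E \<subseteq> inter_pow R X J k"
    using A(1) E_le by (auto simp: inter_pow_def)
  then show "E \<subseteq> A"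
    using E_pow[of p] ideal_pow_mono[of E _ R p] A(2) by blast
qed

theorem proposition4p2:
  fixes R :: "('r, 'x) ring_scheme"
    and I :: "'i set"
    and X :: "'i \<Rightarrow> 'r set"
  assumes "ring R"
    and "I \<noteq> {}"
    and "\<forall>i\<in>I. ideal (X i) R"
    and "pairwise_comaximal R I X"
  shows "(preradical R (gamma_pre R I X :: ('r, 'm) submodule_assignment) \<and>
          left_exact R (gamma_pre R I X :: ('r, 'm) submodule_assignment)) \<and>
    (\<forall>M :: ('r, 'm) module. right_module R M \<longrightarrow>
      internal_direct_sum R M I (\<lambda>i. component R M (X i)) (gamma_pre R I X M) \<and>
      (gamma_pre R I X M = {\<zero>\<^bsub>M\<^esub>} \<longleftrightarrow>
        (\<forall>i\<in>I. \<forall>k::nat. 1 \<le> k \<longrightarrow> left_ann M (ideal_pow R (X i) k) = {\<zero>\<^bsub>M\<^esub>}))) \<and>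
    ((\<forall>J (k :: 'i \<Rightarrow> nat) (n :: nat).
        finite J \<and> J \<noteq> {} \<and> J \<subseteq> I \<and> (\<forall>i\<in>J. 1 \<le> k i) \<and> 1 \<le> n \<longrightarrow>
          fin_gen_ideal R (ideal_pow R (inter_pow R X J k) n)) \<or>
      (finite I \<and>
        (\<forall>k :: 'i \<Rightarrow> nat. (\<forall>i\<in>I. 1 \<le> k i) \<longrightarrow>
          (\<exists>n::nat. 1 \<le> n \<and>
            ideal_pow R (inter_pow R X I k) n = ideal_pow R (inter_pow R X I k) (n + 1))))
      \<longrightarrow> is_radical_closure R (gamma_pre R I X :: ('r, 'm) submodule_assignment) (rho_pre R I X))"
proof -
  interpret ring R
    by fact
  interpret F: directed_ideals R "inter_family R I X"
    using assms(2,3) by (rule directed_inter_family)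
  have "radical R (family_ann R (pow_family R (inter_family R I X)) :: ('r, 'm) submodule_assignment)"
    if fg: "\<forall>J (k :: 'i \<Rightarrow> nat) (n :: nat).
        finite J \<and> J \<noteq> {} \<and> J \<subseteq> I \<and> (\<forall>i\<in>J. 1 \<le> k i) \<and> 1 \<le> n \<longrightarrow>
          fin_gen_ideal R (ideal_pow R (inter_pow R X J k) n)"
  proof (rule F.radical_pow_family_fin_gen)
    show "fin_gen_ideal R A" if "A \<in> pow_family R (inter_family R I X)" for A
      using that fg unfolding pow_family_def inter_family_def by blast
  qed
  moreover have "radical R (family_ann R (pow_family R (inter_family R I X)) :: ('r, 'm) submodule_assignment)"
    if "finite I" and stat: "\<forall>k :: 'i \<Rightarrow> nat. (\<forall>i\<in>I. 1 \<le> k i) \<longrightarrow>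
          (\<exists>n::nat. 1 \<le> n \<and>
            ideal_pow R (inter_pow R X I k) n = ideal_pow R (inter_pow R X I k) (n + 1))"
  proof -
    \<comment> \<open>The constant exponent 1 turns the ideal in condition (b) into the plain
      intersection of all \<open>X i\<close>, whose stationary power is the required least
      member.\<close>
    obtain n where n: "1 \<le> n" "ideal_pow R (inter_pow R X I (\<lambda>_. 1)) n =
        ideal_pow R (inter_pow R X I (\<lambda>_. 1)) (n + 1)"
      using stat[rule_format, of "\<lambda>_. 1"] by auto
    show ?thesis
      using inter_family_least_power[OF \<open>finite I\<close> assms(2,3) n]
      by (rule F.radical_pow_family_idempotent)
  qed
  ultimately have closure: "is_radical_closure R
      (gamma_pre R I X :: ('r, 'm) submodule_assignment) (rho_pre R I X)"
    if "(\<forall>J (k :: 'i \<Rightarrow> nat) (n :: nat).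
        finite J \<and> J \<noteq> {} \<and> J \<subseteq> I \<and> (\<forall>i\<in>J. 1 \<le> k i) \<and> 1 \<le> n \<longrightarrow>
          fin_gen_ideal R (ideal_pow R (inter_pow R X J k) n)) \<or>
      (finite I \<and>
        (\<forall>k :: 'i \<Rightarrow> nat. (\<forall>i\<in>I. 1 \<le> k i) \<longrightarrow>
          (\<exists>n::nat. 1 \<le> n \<and>
            ideal_pow R (inter_pow R X I k) n = ideal_pow R (inter_pow R X I k) (n + 1))))"
    using that F.radical_closure_family_ann unfolding gamma_pre_eq rho_pre_eq by blast
  have "preradical R (gamma_pre R I X :: ('r, 'm) submodule_assignment)"
    "left_exact R (gamma_pre R I X :: ('r, 'm) submodule_assignment)"
    unfolding gamma_pre_eq by (rule F.preradical_family_ann left_exact_family_ann)+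
  moreover have "internal_direct_sum R M I (\<lambda>i. component R M (X i)) (gamma_pre R I X M)"
    if "right_module R M" for M :: "('r, 'm) module"
    using right_module.internal_direct_sum_gamma_pre[OF that assms(2-4)] .
  moreover have "gamma_pre R I X M = {\<zero>\<^bsub>M\<^esub>} \<longleftrightarrow>
      (\<forall>i\<in>I. \<forall>k::nat. 1 \<le> k \<longrightarrow> left_ann M (ideal_pow R (X i) k) = {\<zero>\<^bsub>M\<^esub>})"
    if "right_module R M" for M :: "('r, 'm) module"
    using right_module.gamma_pre_eq_zero_iff[OF that assms(2-4)] .
  ultimately show ?thesis
    using closure by blast
qed

end
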